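(* Let $r\in\mathbb N$, let $V_r=\operatorname{span}(v_1,\dots,v_r)\subset V$ with $v_1,\dots,v_r\in V$, and let $U_r=\operatorname{span}(u_1,\dots,u_r)\subset U$ with $u_i=\mathcal J_U^{-1}B'v_i$ for $i=1,\dots,r$. Let $\hat u^r$ be the unique minimizer of the state-reduced problem $$\min \hat J^r(u)\quad\text{subject to } u\in L^2(0,T;U),$$ and let $\bar u^r$ be the unique minimizer of the control- and state-reduced problem $$\min \hat J^r(u)\quad\text{subject to } u\in L^2(0,T;U_r).$$ Then $\bar u^r=\hat u^r$. In particular, the associated optimal reduced states and optimal reduced adjoint states are equal, that is, $y^r(\bar u^r)=y^r(\hat u^r)$ and $p^r(y^r(\bar u^r))=p^r(y^r(\hat u^r))$.
   Context: Setting: $T>0$; $U,V,H$ are real separable Hilbert spaces with $V\subset H$ compactly and densely embedded; $H$ is identified with its dual, so $V\subset H\subset V'$. $\mathcal L(X,Y)$ is the space of bounded linear operators, $|\cdot|_X$ the norm of $X$, $\mathcal J_X:X\to X'$ the Riesz isomorphism. For $B\in\mathcal L(U,V')$ the dual operator $B'\in\mathcal L(V,U')$ is defined by $\langle B'v,u\rangle_{U',U}=\langle Bu,v\rangle_{V',V}$; $A'(t)$ and $C'(t)$ are the dual (adjoint) operators of $A(t)$ and $C(t)$. Assumptions: (A1) $A\in L^\infty(0,T;\mathcal L(V,V'))$ and there is $\eta_V>0$ with $\langle A(t)v,v\rangle_{V',V}\ge\eta_V|v|_V^2$ for all $t\in(0,T)$, $v\in V$. (A2) $C\in L^\infty(0,T;\mathcal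 L(H,H))$, $B\in\mathcal L(U,V')$, $\beta>0$, $y_d\in L^2(0,T;H)$, $y_0\in H$. Measurability of $A$ means that $t\mapsto\langle A(t)v,w\rangle_{V',V}$ is measurable for all $v,w\in V$, and analogously for $C$. Reduced quantities: $W^r(0,T)=H^1(0,T;V_r')\cap L^2(0,T;V_r)$. For $u\in L^2(0,T;U)$, the reduced state $y^r=y^r(u)\in W^r(0,T)$ is the unique solution of $$\partial_t y^r(t)+A(t)y^r(t)=Bu(t)\ \text{ in } V_r'\text{ for a.e. }t\in(0,T),\qquad y^r(0)=y_0^r,$$ where equality in $V_r'$ means equality when tested with elements of $V_r$, and $y_0^r=\Pi^H_{V_r}y_0\in V_r$ is the $H$-orthogonal projection of $y_0$ onto $V_r$. For $y\in L^2(0,T;H)$, the reduced adjoint state $p^r=p^r(y)\in W^r(0,T)$ is the unique solution of $$-\partial_t p^r(t)+A'(t)p^r(t)=C'(t)(C(t)y(t)-y_d(t))\ \text{ in }V_r'\text{ for a.e. }t\in(0,T),\qquad p^r(T)=0.$$ The reduced cost function is $$\hat J^r(u)=\int_0^T\tfrac12|C(t)y^r(t)-y_d(t)|_H^2+\tfrac\beta2|u(t)|_U^2\,dt,\qquad y^r=y^r(u).$$ *)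

theory Defs
  imports "HOL-Analysis.Analysis"
begin

text \<open>
  The dual of a space \<open>X\<close> is \<open>X \<Rightarrow>\<^sub>L real\<close>, so that \<open>L(V,V')\<close> is \<open>'v \<Rightarrow>\<^sub>L 'v \<Rightarrow>\<^sub>L real\<close>.
  The embedding of \<open>V\<close> into \<open>H\<close> is an explicit operator \<open>\<iota>\<close>, and \<open>H\<close> is included in \<open>V'\<close>
  by \<open>h \<mapsto> (v \<mapsto> h \<bullet> \<iota> v)\<close>.
\<close>

definition compact_dense_embedding :: "('v::real_inner \<Rightarrow>\<^sub>L 'h::real_inner) \<Rightarrow> bool" where
  "compact_dense_embedding \<iota> \<longleftrightarrow>
     inj (blinfun_apply \<iota>) \<and>
     closure (range (blinfun_apply \<iota>)) = UNIV \<and>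
     compact (closure (blinfun_apply \<iota> ` cball 0 1))"

definition dual_op ::
    "('a::real_normed_vector \<Rightarrow>\<^sub>L 'b::real_normed_vector \<Rightarrow>\<^sub>L real) \<Rightarrow> 'b \<Rightarrow>\<^sub>L 'a \<Rightarrow>\<^sub>L real" where
  "dual_op B = Blinfun (\<lambda>v. Blinfun (\<lambda>u. B u v))"

lemma dual_op_apply: "dual_op B v u = B u v"
proof -
  have bb: "bounded_bilinear (\<lambda>u v. blinfun_apply (blinfun_apply B u) v)"
    by (rule bounded_bilinear.comp1[OF bounded_bilinear_blinfun_apply blinfun.bounded_linear_right])
  have inner: "blinfun_apply (Blinfun (\<lambda>u. B u v)) = (\<lambda>u. B u v)" for v
    by (rule bounded_linear_Blinfun_apply[OF bounded_bilinear.bounded_linear_left[OF bb]])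
  have "bounded_bilinear.prod_left (\<lambda>u v. blinfun_apply (blinfun_apply B u) v)
      = (\<lambda>v. Blinfun (\<lambda>u. B u v))"
    by (auto simp: fun_eq_iff inner bounded_bilinear.prod_left.rep_eq[OF bb] intro!: blinfun_eqI)
  then have "bounded_linear (\<lambda>v. Blinfun (\<lambda>u. B u v))"
    using bounded_bilinear.bounded_linear_prod_left[OF bb] by simp
  then show ?thesis
    by (simp add: dual_op_def bounded_linear_Blinfun_apply inner)
qed

text \<open>The Riesz isomorphism \<open>x \<mapsto> (x, \<cdot>)\<close> of a Hilbert space onto its dual.\<close>

abbreviation riesz :: "'a::real_inner \<Rightarrow> 'a \<Rightarrow>\<^sub>L real" where
  "riesz \<equiv> blinfun_inner_right"

abbreviation time_measure :: "real \<Rightarrow> real measure" where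
  "time_measure T \<equiv> lebesgue_on {0<..<T}"

text \<open>
  Representatives of the elements of \<open>L\<^sup>2(0,T;S)\<close>; equality of elements is equality almost
  everywhere. All value spaces used below are separable (for \<open>V'\<close> by the Riesz isomorphism), so
  Borel measurability is strong measurability.
\<close>

definition L2 :: "real \<Rightarrow> 'a::real_normed_vector set \<Rightarrow> (real \<Rightarrow> 'a) set" where
  "L2 T S = {f. f \<in> borel_measurable (time_measure T) \<and>
                integrable (time_measure T) (\<lambda>t. (norm (f t))\<^sup>2) \<and>
                (AE t in time_measure T. f t \<in> S)}"

definition ess_bounded :: "real \<Rightarrow> (real \<Rightarrow> 'a::real_normed_vector) \<Rightarrow> bool" where
  "ess_bounded T f \<longleftrightarrow> (\<exists>M. AE t in time_measure T. norm (f t) \<le> M)"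

text \<open>The spaces \<open>L\<^sup>\<infinity>(0,T;L(V,V'))\<close> and \<open>L\<^sup>\<infinity>(0,T;L(H,H))\<close>, with weak measurability.\<close>

definition Linf_dual_ops :: "real \<Rightarrow> (real \<Rightarrow> 'v::real_inner \<Rightarrow>\<^sub>L 'v \<Rightarrow>\<^sub>L real) set" where
  "Linf_dual_ops T =
     {A. (\<forall>v w. (\<lambda>t. blinfun_apply (blinfun_apply (A t) v) w) \<in> borel_measurable (time_measure T))
         \<and> ess_bounded T A}"

definition Linf_ops :: "real \<Rightarrow> (real \<Rightarrow> 'h::real_inner \<Rightarrow>\<^sub>L 'h) set" where
  "Linf_ops T =
     {C. (\<forall>h k. (\<lambda>t. blinfun_apply (C t) h \<bullet> k) \<in> borel_measurable (time_measure T))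
         \<and> ess_bounded T C}"

definition test_function :: "real \<Rightarrow> (real \<Rightarrow> real) \<Rightarrow> bool" where
  "test_function T \<phi> \<longleftrightarrow>
     \<phi> C1_differentiable_on UNIV \<and>
     compact (closure {t. \<phi> t \<noteq> 0}) \<and> closure {t. \<phi> t \<noteq> 0} \<subseteq> {0<..<T}"

text \<open>
  \<open>g\<close> represents the weak derivative in \<open>L\<^sup>2(0,T;V\<^sub>r')\<close> of \<open>y\<close>, where \<open>Vr \<subseteq> H \<subseteq> Vr'\<close>. Elements of
  \<open>Vr'\<close> are represented by functionals on \<open>V\<close> that are only ever tested with elements of \<open>Vr\<close>;
  so \<open>g\<close> is determined almost everywhere up to functionals vanishing on \<open>Vr\<close>.
\<close>

definition has_weak_time_deriv ::
    "real \<Rightarrow> ('v::real_inner \<Rightarrow>\<^sub>L 'h::real_inner) \<Rightarrow> 'v set \<Rightarrow>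
     (real \<Rightarrow> 'v) \<Rightarrow> (real \<Rightarrow> 'v \<Rightarrow>\<^sub>L real) \<Rightarrow> bool" where
  "has_weak_time_deriv T \<iota> Vr y g \<longleftrightarrow>
     g \<in> L2 T UNIV \<and>
     (\<forall>\<phi>. test_function T \<phi> \<longrightarrow> (\<forall>w\<in>Vr.
        (LINT t|time_measure T. deriv \<phi> t * (\<iota> (y t) \<bullet> \<iota> w)) =
        - (LINT t|time_measure T. \<phi> t * g t w)))"

text \<open>
  \<open>W\<^sup>r(0,T) = H\<^sup>1(0,T;V\<^sub>r') \<inter> L\<^sup>2(0,T;V\<^sub>r)\<close>. Every class in this space has a unique continuous
  representative on \<open>[0,T]\<close>, which is the one we take, so that \<open>y 0\<close> and \<open>y T\<close> make sense.
  Values outside \<open>[0,T]\<close> are irrelevant.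
\<close>

definition Wr :: "real \<Rightarrow> ('v::real_inner \<Rightarrow>\<^sub>L 'h::real_inner) \<Rightarrow> 'v set \<Rightarrow> (real \<Rightarrow> 'v) set" where
  "Wr T \<iota> Vr = {y. y \<in> L2 T Vr \<and> (\<exists>g. has_weak_time_deriv T \<iota> Vr y g) \<and>
                   continuous_on {0..T} y \<and> y ` {0..T} \<subseteq> Vr}"

text \<open>The \<open>H\<close>-orthogonal projection onto the finite-dimensional subspace \<open>Vr\<close> of \<open>V\<close>.\<close>

definition H_proj :: "('v::real_inner \<Rightarrow>\<^sub>L 'h::real_inner) \<Rightarrow> 'v set \<Rightarrow> 'h \<Rightarrow> 'v" where
  "H_proj \<iota> Vr h = (THE w. w \<in> Vr \<and> (\<forall>z\<in>Vr. (h - \<iota> w) \<bullet> \<iota> z = 0))"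

definition solves_reduced_state ::
    "real \<Rightarrow> ('v::real_inner \<Rightarrow>\<^sub>L 'h::real_inner) \<Rightarrow> (real \<Rightarrow> 'v \<Rightarrow>\<^sub>L 'v \<Rightarrow>\<^sub>L real) \<Rightarrow>
     ('u::real_inner \<Rightarrow>\<^sub>L 'v \<Rightarrow>\<^sub>L real) \<Rightarrow> 'h \<Rightarrow> 'v set \<Rightarrow> (real \<Rightarrow> 'u) \<Rightarrow> (real \<Rightarrow> 'v) \<Rightarrow> bool" where
  "solves_reduced_state T \<iota> A B y0 Vr u y \<longleftrightarrow>
     y \<in> Wr T \<iota> Vr \<and>
     (\<exists>dy. has_weak_time_deriv T \<iota> Vr y dy \<and>
        (AE t in time_measure T. \<forall>w\<in>Vr. dy t w + A t (y t) w = B (u t) w)) \<and>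
     y 0 = H_proj \<iota> Vr y0"

text \<open>The solution is unique on \<open>[0,T]\<close>; the choice only concerns values outside \<open>[0,T]\<close>.\<close>

definition reduced_state ::
    "real \<Rightarrow> ('v::real_inner \<Rightarrow>\<^sub>L 'h::real_inner) \<Rightarrow> (real \<Rightarrow> 'v \<Rightarrow>\<^sub>L 'v \<Rightarrow>\<^sub>L real) \<Rightarrow>
     ('u::real_inner \<Rightarrow>\<^sub>L 'v \<Rightarrow>\<^sub>L real) \<Rightarrow> 'h \<Rightarrow> 'v set \<Rightarrow> (real \<Rightarrow> 'u) \<Rightarrow> (real \<Rightarrow> 'v)" where
  "reduced_state T \<iota> A B y0 Vr u = (SOME y. solves_reduced_state T \<iota> A B y0 Vr u y)"

definition solves_reduced_adjoint ::
    "real \<Rightarrow> ('v::real_inner \<Rightarrow>\<^sub>L 'h::real_inner) \<Rightarrow> (real \<Rightarrow> 'v \<Rightarrow>\<^sub>L 'v \<Rightarrow>\<^sub>L real) \<Rightarrow>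
     (real \<Rightarrow> 'h \<Rightarrow>\<^sub>L 'h) \<Rightarrow> (real \<Rightarrow> 'h) \<Rightarrow> 'v set \<Rightarrow> (real \<Rightarrow> 'h) \<Rightarrow> (real \<Rightarrow> 'v) \<Rightarrow> bool" where
  "solves_reduced_adjoint T \<iota> A C yd Vr y p \<longleftrightarrow>
     p \<in> Wr T \<iota> Vr \<and>
     (\<exists>dp. has_weak_time_deriv T \<iota> Vr p dp \<and>
        (AE t in time_measure T. \<forall>w\<in>Vr.
           - dp t w + dual_op (A t) (p t) w
             = adjoint (blinfun_apply (C t)) (C t (y t) - yd t) \<bullet> \<iota> w)) \<and>
     p T = 0"

definition reduced_adjoint_state ::
    "real \<Rightarrow> ('v::real_inner \<Rightarrow>\<^sub>L 'h::real_inner) \<Rightarrow> (real \<Rightarrow> 'v \<Rightarrow>\<^sub>L 'v \<Rightarrow>\<^sub>L real) \<Rightarrow>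
     (real \<Rightarrow> 'h \<Rightarrow>\<^sub>L 'h) \<Rightarrow> (real \<Rightarrow> 'h) \<Rightarrow> 'v set \<Rightarrow> (real \<Rightarrow> 'h) \<Rightarrow> (real \<Rightarrow> 'v)" where
  "reduced_adjoint_state T \<iota> A C yd Vr y = (SOME p. solves_reduced_adjoint T \<iota> A C yd Vr y p)"

definition reduced_cost ::
    "real \<Rightarrow> ('v::real_inner \<Rightarrow>\<^sub>L 'h::real_inner) \<Rightarrow> (real \<Rightarrow> 'v \<Rightarrow>\<^sub>L 'v \<Rightarrow>\<^sub>L real) \<Rightarrow>
     ('u::real_inner \<Rightarrow>\<^sub>L 'v \<Rightarrow>\<^sub>L real) \<Rightarrow> (real \<Rightarrow> 'h \<Rightarrow>\<^sub>L 'h) \<Rightarrow> real \<Rightarrow> (real \<Rightarrow> 'h) \<Rightarrow> 'h \<Rightarrow>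
     'v set \<Rightarrow> (real \<Rightarrow> 'u) \<Rightarrow> real" where
  "reduced_cost T \<iota> A B C \<beta> yd y0 Vr u =
     (LINT t|time_measure T.
        1/2 * (norm (C t (\<iota> (reduced_state T \<iota> A B y0 Vr u t)) - yd t))\<^sup>2
        + \<beta>/2 * (norm (u t))\<^sup>2)"

end

theory Submission
  imports Defs
begin

text \<open>
  A control enters the reduced state equation only through \<open>B (u t) w\<close> with \<open>w\<close> in \<open>Vr\<close>, and by
  definition of \<open>Ur\<close> this value does not change if \<open>u t\<close> is replaced by its orthogonal projection
  \<open>P (u t)\<close> onto \<open>Ur\<close>. So \<open>u\<close> and \<open>P \<circ> u\<close> have the same reduced state, while the control cost of
  \<open>P \<circ> u\<close> is not larger. Hence \<open>ubar\<close>, being at least as good as \<open>P \<circ> uhat\<close>, minimizes the cost over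
  all controls as well, and the minimizer is unique because the cost is strictly convex.

  Strict convexity uses that the state is an affine function of the control, that is, existence and
  uniqueness for the reduced equation. In a basis of \<open>Vr\<close> that is orthonormal in \<open>H\<close>, the equation is
  a linear ordinary differential equation with bounded measurable coefficients, equivalent to an
  integral equation: one direction is Fubini's theorem, the other the du Bois-Reymond lemma.
\<close>

subsection \<open>Hilbert spaces and measurability\<close>

lemma riesz_representation:
  fixes f :: "'a::{real_inner,banach} \<Rightarrow>\<^sub>L real"
  shows "\<exists>x. riesz x = f"
proof -
  define q where "q x = (norm x)\<^sup>2 / 2 - f x" for x
  have lower: "- (norm f)\<^sup>2 / 2 \<le> q x" for x
  proof -
    have "f x \<le> norm f * norm x"
      using norm_blinfun[of f x] by simp
    also have "\<dots> \<le> (norm x)\<^sup>2 / 2 + (norm f)\<^sup>2 / 2"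
      using sum_squares_bound[of "norm f" "norm x"] by simp
    finally show ?thesis by (simp add: q_def)
  qed
  define m where "m = Inf (range q)"
  have bdd: "bdd_below (range q)"
    using lower by (auto intro!: bdd_belowI)
  have m_le: "m \<le> q x" for x
    unfolding m_def using bdd by (intro cInf_lower) auto
  have "\<exists>x. q x < m + 1 / real (Suc n)" for n
  proof -
    have "Inf (range q) < m + 1 / real (Suc n)"
      by (simp add: m_def)
    then show ?thesis
      using cInf_lessD[of "range q"] by blast
  qed
  then obtain X where X: "\<And>n. q (X n) < m + 1 / real (Suc n)"
    by metis
  have par: "(norm (x - y))\<^sup>2 / 4 = q x + q y - 2 * q ((1/2) *\<^sub>R (x + y))" for x y
    by (simp add: q_def power2_norm_eq_inner blinfun.scaleR_right blinfun.add_right blinfun.diff_right algebra_simps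
        inner_commute add_divide_distrib diff_divide_distrib)
  have "Cauchy X"
  proof (rule metric_CauchyI)
    fix e :: real assume e: "0 < e"
    obtain N where N: "1 / real (Suc N) < e\<^sup>2 / 8"
      using e nat_approx_posE[of "e\<^sup>2 / 8"] by auto
    have "dist (X i) (X j) < e" if "N \<le> i" "N \<le> j" for i j
    proof -
      have "1 / real (Suc i) \<le> 1 / real (Suc N)" "1 / real (Suc j) \<le> 1 / real (Suc N)"
        using that by (auto intro!: frac_le)
      then have "(norm (X i - X j))\<^sup>2 / 4 < e\<^sup>2 / 4"
        using par[of "X i" "X j"] X[of i] X[of j] m_le[of "(1/2) *\<^sub>R (X i + X j)"] N by linarith
      then show ?thesis
        using e by (simp add: dist_norm power2_less_imp_less)
    qed
    then show "\<exists>M. \<forall>i\<ge>M. \<forall>j\<ge>M. dist (X i) (X j) < e" by blast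
  qed
  then obtain x where x: "X \<longlonglongrightarrow> x"
    using Cauchy_convergent_iff convergent_def by blast
  have "(\<lambda>n. q (X n)) \<longlonglongrightarrow> q x"
    unfolding q_def using x by (auto intro!: tendsto_intros)
  moreover have "(\<lambda>n. m + 1 / real (Suc n)) \<longlonglongrightarrow> m + 0"
    by (intro tendsto_intros LIMSEQ_Suc lim_1_over_n)
  ultimately have "q x \<le> m"
    using X by (intro LIMSEQ_le[of "\<lambda>n. q (X n)" _ "\<lambda>n. m + 1 / real (Suc n)"]) (auto intro: less_imp_le)
  then have min: "q x \<le> q y" for y
    using m_le[of y] by simp
  have "x \<bullet> h = f h" for h
  proof (cases "h = 0")
    case False
    define s where "s = x \<bullet> h - f h"
    define c where "c = - s / (norm h)\<^sup>2"
    have "(norm (x + c *\<^sub>R h))\<^sup>2 = (norm x)\<^sup>2 + 2 * c * (x \<bullet> h) + c\<^sup>2 * (norm h)\<^sup>2"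
      unfolding power2_norm_eq_inner by (simp add: algebra_simps inner_commute power2_eq_square)
    then have "q (x + c *\<^sub>R h) - q x = c * s + c\<^sup>2 * (norm h)\<^sup>2 / 2"
      by (simp add: q_def s_def blinfun.scaleR_right blinfun.add_right field_simps)
    also have "\<dots> = - s\<^sup>2 / (2 * (norm h)\<^sup>2)"
      using False by (simp add: c_def field_simps power2_eq_square)
    finally have "s\<^sup>2 / (2 * (norm h)\<^sup>2) \<le> 0"
      using min[of "x + c *\<^sub>R h"] by simp
    then have "s\<^sup>2 \<le> 0"
      using False by (simp add: divide_le_0_iff)
    then show ?thesis by (simp add: s_def)
  qed simp
  then show ?thesis
    by (intro exI[of _ x] blinfun_eqI) simp
qed

lemma orthonormal_basis_pullback:
  fixes j :: "'a::real_inner \<Rightarrow>\<^sub>L 'b::real_inner"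
  assumes "inj (blinfun_apply j)" "finite S"
  obtains E where "finite E" "E \<subseteq> span S"
    "\<And>e f. e \<in> E \<Longrightarrow> f \<in> E \<Longrightarrow> j e \<bullet> j f = (if e = f then 1 else 0)"
    "\<And>w. w \<in> span S \<Longrightarrow> (\<Sum>e\<in>E. (j w \<bullet> j e) *\<^sub>R e) = w"
proof -
  obtain D where D: "finite D" "span D = span (j ` S)" "pairwise orthogonal D"
    using basis_orthogonal[of "j ` S"] assms(2) by auto
  have lin: "linear (blinfun_apply j)"
    by (simp add: blinfun.bounded_linear_right bounded_linear.linear)
  have spanj: "span (j ` S) = j ` span S"
    using linear_span_image[OF lin] by simp
  define g where "g d = inv (blinfun_apply j) (d /\<^sub>R norm d)" for d
  define E where "E = g ` (D - {0})"
  have gd: "g d \<in> span S" "j (g d) = d /\<^sub>R norm d" if "d \<in> D" for d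
  proof -
    have "d /\<^sub>R norm d \<in> span D"
      using that by (simp add: span_base span_scale)
    then obtain x where "x \<in> span S" "d /\<^sub>R norm d = j x"
      using D spanj by auto
    then show "g d \<in> span S" "j (g d) = d /\<^sub>R norm d"
      using assms(1) by (simp_all add: g_def inv_f_f)
  qed
  have on: "j e \<bullet> j f = (if e = f then 1 else 0)" if "e \<in> E" "f \<in> E" for e f
  proof -
    obtain d where d: "d \<in> D" "d \<noteq> 0" "e = g d"
      using \<open>e \<in> E\<close> by (auto simp: E_def)
    obtain d' where d': "d' \<in> D" "d' \<noteq> 0" "f = g d'"
      using \<open>f \<in> E\<close> by (auto simp: E_def)
    show ?thesis
    proof (cases "d = d'")
      case True
      then show ?thesis using d d' gd
        by (simp add: power2_norm_eq_inner[symmetric] power2_eq_square)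
    next
      case False
      then have "j e \<bullet> j f = 0"
        using D(3) d d' gd by (simp add: pairwise_def orthogonal_def)
      moreover have "e \<noteq> f"
      proof
        assume "e = f"
        moreover have "j e \<noteq> 0" using d gd by simp
        ultimately show False using \<open>j e \<bullet> j f = 0\<close> by simp
      qed
      ultimately show ?thesis by simp
    qed
  qed
  have fin: "finite E" and sub: "E \<subseteq> span S"
    using D gd by (auto simp: E_def)
  have dE: "j ` S \<subseteq> span (j ` E)"
  proof -
    have "d \<in> span (j ` E)" if "d \<in> D" for d
    proof (cases "d = 0")
      case False
      then have "norm d *\<^sub>R j (g d) = d" using gd that by simp
      moreover have "j (g d) \<in> span (j ` E)"
        using False that by (auto simp: E_def intro!: span_base)
      ultimately show ?thesis using span_scale by metis
    qed (simp add: span_zero)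
    then have "span D \<subseteq> span (j ` E)"
      by (intro span_minimal subspace_span subsetI)
    then show ?thesis
      unfolding D(2) by (rule order_trans[OF span_superset])
  qed
  then have "span (j ` S) \<subseteq> span (j ` E)"
    by (rule span_minimal) (rule subspace_span)
  then have "j ` span S \<subseteq> j ` span E"
    using spanj linear_span_image[OF lin] by simp
  then have spanE: "span S \<subseteq> span E"
    using assms(1) by (simp add: inj_image_subset_iff)
  have "(\<Sum>e\<in>E. (j w \<bullet> j e) *\<^sub>R e) = w" if "w \<in> span S" for w
  proof -
    have "w \<in> span E" using that spanE by auto
    then obtain c where w: "w = (\<Sum>e\<in>E. c e *\<^sub>R e)"
      using span_finite[OF fin] by auto
    have "j w \<bullet> j e = c e" if "e \<in> E" for e
    proof -
      have "j w \<bullet> j e = (\<Sum>f\<in>E. c f * (j f \<bullet> j e))"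
        by (simp add: w blinfun.sum_right blinfun.scaleR_right inner_sum_left)
      also have "\<dots> = (\<Sum>f\<in>E. if f = e then c f else 0)"
        using that on by (intro sum.cong) auto
      finally show ?thesis using fin that by simp
    qed
    then show ?thesis by (simp add: w)
  qed
  then show thesis using that fin sub on by blast
qed

lemma borel_measurable_caratheodory:
  fixes F :: "'a \<Rightarrow> 'x::{metric_space,second_countable_topology} \<Rightarrow> 'y::metric_space"
  assumes meas: "\<And>x. (\<lambda>t. F t x) \<in> borel_measurable M"
    and cont: "\<And>t. t \<in> space M \<Longrightarrow> continuous_on UNIV (F t)"
    and f: "f \<in> borel_measurable M"
  shows "(\<lambda>t. F t (f t)) \<in> borel_measurable M"
proof -
  obtain s where s: "\<And>i. simple_function M (s i)"
      "\<And>t. t \<in> space M \<Longrightarrow> (\<lambda>i. s i t) \<longlonglongrightarrow> f t"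
    using borel_measurable_implies_sequence_metric[OF f] by metis
  have "(\<lambda>t. F t (s i t)) \<in> borel_measurable M" for i
  proof (rule measurable_compose_countable'[where I = "s i ` space M" and g = "s i" and f = "\<lambda>x t. F t x"])
    show "countable (s i ` space M)"
      using simple_functionD(1)[OF s(1)] by (rule countable_finite)
    show "s i \<in> M \<rightarrow>\<^sub>M count_space (s i ` space M)"
      using measurable_simple_function[OF s(1)[of i]] by (auto simp: measurable_def)
  qed (rule meas)
  moreover have "(\<lambda>i. F t (s i t)) \<longlonglongrightarrow> F t (f t)" if "t \<in> space M" for t
    using continuous_on_tendsto_compose[OF cont[OF that] s(2)[OF that]] by simp
  ultimately show ?thesis
    by (rule borel_measurable_LIMSEQ_metric)
qed

lemma borel_measurable_norm_weak:
  fixes f :: "'a \<Rightarrow> 'h::{real_inner,second_countable_topology}"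
  assumes "\<And>k. (\<lambda>t. f t \<bullet> k) \<in> borel_measurable M"
  shows "(\<lambda>t. norm (f t)) \<in> borel_measurable M"
proof -
  obtain D :: "'h set" where D: "countable D" "\<And>X. open X \<Longrightarrow> X \<noteq> {} \<Longrightarrow> \<exists>d\<in>D. d \<in> X"
    by (erule countable_dense_setE)
  have cl: "x \<in> closure D" for x
    using D(2) by (fastforce simp: closure_iff_nhds_not_empty)
  have eq: "norm x \<le> a \<longleftrightarrow> (\<forall>d\<in>D. x \<bullet> d \<le> a * norm d)" if a: "0 \<le> a" for x :: 'h and a
  proof
    assume "norm x \<le> a"
    then show "\<forall>d\<in>D. x \<bullet> d \<le> a * norm d"
      by (meson mult_right_mono norm_cauchy_schwarz norm_ge_zero order_trans)
  next
    assume *: "\<forall>d\<in>D. x \<bullet> d \<le> a * norm d"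
    obtain d where "\<And>n. d n \<in> D" "d \<longlonglongrightarrow> x"
      using cl[of x] closure_sequential by blast
    then have "x \<bullet> x \<le> a * norm x" using *
      by (intro LIMSEQ_le[of "\<lambda>n. x \<bullet> d n" _ "\<lambda>n. a * norm (d n)"] tendsto_intros) auto
    then show "norm x \<le> a"
      using a by (cases "x = 0") (simp_all add: power2_norm_eq_inner[symmetric] power2_eq_square)
  qed
  show ?thesis
  proof (rule borel_measurable_iff_le[THEN iffD2], rule allI)
    fix a
    show "{t \<in> space M. norm (f t) \<le> a} \<in> sets M"
    proof (cases "0 \<le> a")
      case True
      have "{t \<in> space M. \<forall>d\<in>D. f t \<bullet> d \<le> a * norm d} \<in> sets M"
        using assms D(1) by measurable
      then show ?thesis using eq[OF True] by simp
    next
      case False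
      then have empty: "{t \<in> space M. norm (f t) \<le> a} = {}"
        by (auto simp: not_le intro: less_le_trans)
      show ?thesis unfolding empty by simp
    qed
  qed
qed

subsection \<open>Indefinite Bochner integrals on the time interval\<close>

definition time_integral :: "real \<Rightarrow> (real \<Rightarrow> 'a::{banach,second_countable_topology}) \<Rightarrow> real \<Rightarrow> 'a" where
  "time_integral T g t = (LINT s|time_measure T. indicator {..t} s *\<^sub>R g s)"

lemma finite_measure_time: "finite_measure (time_measure T)"
  by (rule finite_measure_lebesgue_on) simp

lemma measurable_time_id [measurable]: "(\<lambda>s. s) \<in> borel_measurable (time_measure T)"
  by (rule continuous_imp_measurable_on_sets_lebesgue) auto

lemma measurable_time_continuous:
  "continuous_on {0..T} f \<Longrightarrow> f \<in> borel_measurable (time_measure T)"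
  by (rule continuous_imp_measurable_on_sets_lebesgue) (auto elim: continuous_on_subset)

lemma integrable_time_bounded:
  fixes f :: "real \<Rightarrow> 'a::{banach,second_countable_topology}"
  assumes "f \<in> borel_measurable (time_measure T)" "\<And>t. t \<in> {0..T} \<Longrightarrow> norm (f t) \<le> K"
  shows "integrable (time_measure T) f"
  using assms by (intro finite_measure.integrable_const_bound[OF finite_measure_time, where B = K] AE_I2) auto

lemma bounded_on_Icc:
  fixes f :: "real \<Rightarrow> 'a::real_normed_vector"
  assumes "continuous_on {a..b} f"
  obtains K where "\<And>t. t \<in> {a..b} \<Longrightarrow> norm (f t) \<le> K" "0 < K"
  using compact_imp_bounded[OF compact_continuous_image[OF assms compact_Icc]]
  by (auto simp: bounded_pos intro: that)

lemma integrable_time_continuous: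
  fixes f :: "real \<Rightarrow> 'a::{banach,second_countable_topology}"
  assumes "continuous_on {0..T} f"
  shows "integrable (time_measure T) f"
  using bounded_on_Icc[OF assms] integrable_time_bounded[OF measurable_time_continuous[OF assms]]
  by metis

lemma integral_time_eq_integral:
  fixes f :: "real \<Rightarrow> real"
  assumes "integrable (time_measure T) f"
  shows "integral\<^sup>L (time_measure T) f = integral {0..T} f"
  using lebesgue_integral_eq_integral[OF assms] integral_open_interval_real[of 0 T f] by simp

lemma integral_time_FTC:
  fixes F f :: "real \<Rightarrow> real"
  assumes "0 \<le> a" "a \<le> b" "b \<le> T"
    and der: "\<And>t. t \<in> {a..b} \<Longrightarrow> (F has_real_derivative f t) (at t within {a..b})"
    and cont: "continuous_on {a..b} f"
  shows "(LINT s|time_measure T. indicator {a..b} s * f s) = F b - F a"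
proof -
  have eq: "(\<lambda>s. indicator {a..b} s * f s) = (\<lambda>s. if s \<in> {a..b} then f s else 0)"
    by (auto simp: indicator_def)
  obtain K where K: "\<And>t. t \<in> {a..b} \<Longrightarrow> norm (f t) \<le> K" "0 < K"
    using bounded_on_Icc[OF cont] by blast
  have "(\<lambda>s. indicator {a..b} s *\<^sub>R f s) \<in> borel_measurable lebesgue"
    using continuous_imp_measurable_on_sets_lebesgue[OF cont]
    by (simp add: borel_measurable_restrict_space_iff)
  then have "(\<lambda>s. indicator {a..b} s * f s) \<in> borel_measurable (time_measure T)"
    by (simp add: measurable_restrict_space1)
  then have "integrable (time_measure T) (\<lambda>s. indicator {a..b} s * f s)"
    using K by (intro integrable_time_bounded[where K = K]) (auto simp: indicator_def)
  then have "(LINT s|time_measure T. indicator {a..b} s * f s) = integral {0..T} (\<lambda>s. indicator {a..b} s * f s)"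
    by (rule integral_time_eq_integral)
  also have "\<dots> = integral {a..b} f"
    unfolding eq Henstock_Kurzweil_Integration.integral_restrict_Int
    using assms(1-3) by (intro arg_cong2[where f = integral]) auto
  also have "\<dots> = F b - F a"
    using assms by (intro integral_unique fundamental_theorem_of_calculus)
      (auto simp: has_real_derivative_iff_has_vector_derivative)
  finally show ?thesis .
qed

lemma integrable_time_indicator:
  fixes g :: "real \<Rightarrow> 'a::{banach,second_countable_topology}"
  assumes "integrable (time_measure T) g"
  shows "integrable (time_measure T) (\<lambda>s. indicator {..t} s *\<^sub>R g s)"
proof -
  have "(\<lambda>s. indicator {..t} s *\<^sub>R g s) \<in> borel_measurable (time_measure T)"
    using assms by measurable
  then show ?thesis
    by (rule Bochner_Integration.integrable_bound[OF assms]) (auto simp: indicator_def)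
qed

lemma time_integral_0: "time_integral T g 0 = 0"
proof -
  have "time_integral T g 0 = (LINT s|time_measure T. 0)"
    unfolding time_integral_def by (intro Bochner_Integration.integral_cong) (auto simp: indicator_def)
  then show ?thesis by simp
qed

lemma time_integral_cong_AE:
  assumes "f \<in> borel_measurable (time_measure T)" "g \<in> borel_measurable (time_measure T)"
    and "AE t in time_measure T. f t = g t"
  shows "time_integral T f t = time_integral T g t"
  unfolding time_integral_def using assms by (intro integral_cong_AE) auto

lemma time_integral_add:
  assumes "integrable (time_measure T) f" "integrable (time_measure T) g"
  shows "time_integral T (\<lambda>s. f s + g s) t = time_integral T f t + time_integral T g t"
  using assms[THEN integrable_time_indicator]
  by (simp add: time_integral_def scaleR_add_right)

lemma time_integral_diff:
  assumes "integrable (time_measure T) f" "integrable (time_measure T) g"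
  shows "time_integral T (\<lambda>s. f s - g s) t = time_integral T f t - time_integral T g t"
  using assms[THEN integrable_time_indicator]
  by (simp add: time_integral_def scaleR_diff_right)

lemma time_integral_scaleR: "time_integral T (\<lambda>s. c *\<^sub>R f s) t = c *\<^sub>R time_integral T f t"
  unfolding time_integral_def scaleR_left_commute[of _ c] by (rule integral_scaleR_right)

lemma time_integral_sum_scaleR:
  assumes "\<And>i. i \<in> I \<Longrightarrow> integrable (time_measure T) (f i)"
  shows "time_integral T (\<lambda>s. \<Sum>i\<in>I. f i s *\<^sub>R e i) t = (\<Sum>i\<in>I. time_integral T (f i) t *\<^sub>R e i)"
proof -
  have "time_integral T (\<lambda>s. \<Sum>i\<in>I. f i s *\<^sub>R e i) t
      = (LINT s|time_measure T. (\<Sum>i\<in>I. (indicator {..t} s *\<^sub>R f i s) *\<^sub>R e i))"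
    by (simp add: time_integral_def scaleR_sum_right)
  also have "\<dots> = (\<Sum>i\<in>I. LINT s|time_measure T. (indicator {..t} s *\<^sub>R f i s) *\<^sub>R e i)"
    using integrable_time_indicator[OF assms]
    by (intro Bochner_Integration.integral_sum integrable_scaleR_left) 
  also have "\<dots> = (\<Sum>i\<in>I. time_integral T (f i) t *\<^sub>R e i)"
    using integrable_time_indicator[OF assms]
    by (simp add: time_integral_def del: scaleR_scaleR scaleR_conv_of_real real_scaleR_def)
  finally show ?thesis .
qed

lemma time_integral_FTC:
  fixes F f :: "real \<Rightarrow> real"
  assumes "t \<in> {0..T}" "\<And>t. (F has_real_derivative f t) (at t)" "continuous_on UNIV f"
  shows "time_integral T f t = F t - F 0"
proof -
  have "time_integral T f t = (LINT s|time_measure T. indicator {0..t} s * f s)"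
    unfolding time_integral_def by (intro Bochner_Integration.integral_cong) (auto simp: indicator_def)
  also have "\<dots> = F t - F 0"
    using assms by (intro integral_time_FTC) (auto intro: has_field_derivative_at_within continuous_on_subset)
  finally show ?thesis .
qed

lemma norm_time_integral_le:
  assumes "integrable (time_measure T) k" "AE s in time_measure T. s \<le> t \<longrightarrow> norm (g s) \<le> k s"
    "AE s in time_measure T. 0 \<le> k s"
  shows "norm (time_integral T g t) \<le> time_integral T k t"
proof -
  have "norm (time_integral T g t) \<le> (LINT s|time_measure T. norm (indicator {..t} s *\<^sub>R g s))"
    unfolding time_integral_def by (rule integral_norm_bound)
  also have "\<dots> \<le> time_integral T k t"
    unfolding time_integral_def using assms(2,3)
    by (intro integral_mono_AE' integrable_time_indicator assms(1)) (auto simp: indicator_def)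
  finally show ?thesis .
qed

lemma AE_time_singleton: "AE s in time_measure T. s \<noteq> c"
  using AE_completion[OF AE_lborel_singleton[of c]]
  by (auto simp: AE_restrict_space_iff elim: eventually_mono)

lemma continuous_on_time_integral:
  assumes g: "integrable (time_measure T) g"
  shows "continuous_on S (time_integral T g)"
proof -
  have "continuous (at t) (time_integral T g)" for t
    unfolding continuous_at_sequentially o_def
  proof (intro allI impI)
    fix x :: "nat \<Rightarrow> real" assume x: "x \<longlonglongrightarrow> t"
    have lim: "(\<lambda>n. indicator {..x n} s *\<^sub>R g s) \<longlonglongrightarrow> indicator {..t} s *\<^sub>R g s" if "s \<noteq> t" for s
    proof (rule tendsto_eventually)
      have "\<forall>\<^sub>F n in sequentially. (s \<le> x n \<longleftrightarrow> s \<le> t)"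
      proof (cases "s < t")
        case True
        then show ?thesis using order_tendstoD(1)[OF x, of s] by (auto elim: eventually_mono)
      next
        case False
        then show ?thesis using order_tendstoD(2)[OF x, of s] that by (auto elim: eventually_mono)
      qed
      then show "\<forall>\<^sub>F n in sequentially. indicator {..x n} s *\<^sub>R g s = indicator {..t} s *\<^sub>R g s"
        by eventually_elim (simp add: indicator_def)
    qed
    show "(\<lambda>n. time_integral T g (x n)) \<longlonglongrightarrow> time_integral T g t"
      unfolding time_integral_def
    proof (rule integral_dominated_convergence[where w = "\<lambda>s. norm (g s)"])
      show "AE s in time_measure T. (\<lambda>n. indicator {..x n} s *\<^sub>R g s) \<longlonglongrightarrow> indicator {..t} s *\<^sub>R g s"
        by (rule eventually_mono[OF AE_time_singleton[of t T]]) (rule lim)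
    qed (use g integrable_time_indicator[OF g] in \<open>auto simp: indicator_def\<close>)
  qed
  then show ?thesis by (simp add: continuous_at_imp_continuous_on)
qed

subsection \<open>Weak derivatives\<close>

lemma test_functionD:
  assumes "test_function T \<phi>"
  shows "(\<phi> has_real_derivative deriv \<phi> t) (at t)"
    and "continuous_on S (deriv \<phi>)"
    and "t \<notin> {0<..<T} \<Longrightarrow> \<phi> t = 0"
proof -
  obtain D where D: "\<And>x. (\<phi> has_vector_derivative D x) (at x)" "continuous_on UNIV D"
    using assms by (auto simp: test_function_def C1_differentiable_on_def)
  have der: "(\<phi> has_real_derivative D x) (at x)" for x
    using D(1) by (simp add: has_real_derivative_iff_has_vector_derivative)
  then have "deriv \<phi> = D"
    by (auto intro: DERIV_imp_deriv)
  then show "(\<phi> has_real_derivative deriv \<phi> t) (at t)" "continuous_on S (deriv \<phi>)"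
    using der D(2) by (auto intro: continuous_on_subset)
  show "\<phi> t = 0" if "t \<notin> {0<..<T}"
    using assms that closure_subset[of "{t. \<phi> t \<noteq> 0}"] by (auto simp: test_function_def)
qed

lemma test_function_integral_deriv:
  assumes "0 < T" "test_function T \<phi>"
  shows "(LINT t|time_measure T. deriv \<phi> t) = 0"
proof -
  have "(LINT t|time_measure T. deriv \<phi> t) = (LINT t|time_measure T. indicator {0..T} t * deriv \<phi> t)"
    by (intro Bochner_Integration.integral_cong) auto
  also have "\<dots> = \<phi> T - \<phi> 0"
    using assms test_functionD[OF assms(2)]
    by (intro integral_time_FTC) (auto intro: has_field_derivative_at_within)
  finally show ?thesis
    using test_functionD(3)[OF assms(2)] by simp
qed

lemma weak_derivative_time_integral:
  fixes g :: "real \<Rightarrow> real"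
  assumes T: "0 < T" and \<phi>: "test_function T \<phi>" and g: "integrable (time_measure T) g"
  shows "(LINT t|time_measure T. deriv \<phi> t * time_integral T g t)
       = - (LINT t|time_measure T. \<phi> t * g t)"
proof -
  let ?M = "time_measure T"
  interpret M: finite_measure ?M by (rule finite_measure_time)
  interpret pair_sigma_finite ?M ?M ..
  define f where "f t s = deriv \<phi> t * (indicator {..t} s * g s)" for t s
  have [measurable]: "g \<in> borel_measurable ?M" "deriv \<phi> \<in> borel_measurable ?M"
    using g by (auto intro: measurable_time_continuous test_functionD(2)[OF \<phi>])
  obtain K where K: "\<And>t. t \<in> {0..T} \<Longrightarrow> norm (deriv \<phi> t) \<le> K" "0 < K"
    using bounded_on_Icc[OF test_functionD(2)[OF \<phi>]] by blast
  have dom: "integrable (?M \<Otimes>\<^sub>M ?M) (\<lambda>(t, s). K * g s)"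
    using g by (intro Fubini_integrable) auto
  have [measurable]: "fst \<in> borel_measurable (?M \<Otimes>\<^sub>M ?M)" "snd \<in> borel_measurable (?M \<Otimes>\<^sub>M ?M)"
    using measurable_compose[OF measurable_fst measurable_time_id]
      measurable_compose[OF measurable_snd measurable_time_id] by auto
  have f_eq: "case_prod f = (\<lambda>p. deriv \<phi> (fst p) * ((if snd p \<le> fst p then 1 else 0) * g (snd p)))"
    by (auto simp: f_def indicator_def)
  have "case_prod f \<in> borel_measurable (?M \<Otimes>\<^sub>M ?M)"
    unfolding f_eq by measurable
  then have int: "integrable (?M \<Otimes>\<^sub>M ?M) (case_prod f)"
    using K by (intro Bochner_Integration.integrable_bound[OF dom] AE_I2)
      (auto simp: f_def abs_mult indicator_def space_pair_measure intro!: mult_mono)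
  have "(LINT t|?M. deriv \<phi> t * time_integral T g t) = (LINT t|?M. LINT s|?M. f t s)"
    by (simp add: time_integral_def f_def)
  also have "\<dots> = (LINT s|?M. LINT t|?M. f t s)"
    using Fubini_integral[OF int] by simp
  also have "\<dots> = (LINT s|?M. - (\<phi> s * g s))"
  proof (rule Bochner_Integration.integral_cong)
    fix s assume "s \<in> space ?M"
    then have s: "0 < s" "s < T" by auto
    have "(LINT t|?M. f t s) = (LINT t|?M. g s * (indicator {s..T} t * deriv \<phi> t))"
      by (intro Bochner_Integration.integral_cong) (auto simp: f_def indicator_def)
    also have "\<dots> = g s * (\<phi> T - \<phi> s)"
      using s integral_time_FTC[of s T T \<phi> "deriv \<phi>"] test_functionD[OF \<phi>]
      by (simp add: has_field_derivative_at_within)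
    finally show "(LINT t|?M. f t s) = - (\<phi> s * g s)"
      using test_functionD(3)[OF \<phi>, of T] by (simp add: algebra_simps)
  qed simp
  finally show ?thesis by simp
qed

lemma DERIV_max0_square:
  "((\<lambda>x. (max 0 x)\<^sup>2 / 2) has_real_derivative max 0 x) (at (x::real))"
proof -
  have bound: "\<bar>(max 0 y)\<^sup>2 / 2 - (max 0 x)\<^sup>2 / 2 - max 0 x * (y - x)\<bar> \<le> (y - x)\<^sup>2 / 2" (is "\<bar>?r\<bar> \<le> _") for y
  proof -
    have sq: "(y - x)\<^sup>2 / 2 = x\<^sup>2 / 2 + y\<^sup>2 / 2 - x * y"
      by (simp add: power2_eq_square field_simps)
    consider "0 \<le> x" "0 \<le> y" | "0 \<le> x" "y < 0" | "x < 0" "0 \<le> y" | "x < 0" "y < 0" by linarith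
    then show ?thesis
    proof cases
      case 1
      then have "?r = (y - x)\<^sup>2 / 2"
        by (simp add: max_def power2_eq_square field_simps)
      then show ?thesis by (simp only: abs_of_nonneg zero_le_power2 divide_nonneg_pos zero_less_numeral)
    next
      case 2
      then have "?r = x\<^sup>2 / 2 - x * y" "x * y \<le> 0"
        by (simp_all add: max_def power2_eq_square field_simps mult_nonneg_nonpos)
      then show ?thesis
        using zero_le_power2[of x] zero_le_power2[of y] sq unfolding abs_le_iff by linarith
    next
      case 3
      then have "?r = y\<^sup>2 / 2" "x * y \<le> 0"
        by (simp_all add: max_def mult_nonpos_nonneg)
      then show ?thesis
        using zero_le_power2[of x] zero_le_power2[of y] sq unfolding abs_le_iff by linarith
    next
      case 4
      then have "?r = 0" by (simp add: max_def)
      then show ?thesis by simp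
    qed
  qed
  have "(\<lambda>h. ((max 0 (x + h))\<^sup>2 / 2 - (max 0 x)\<^sup>2 / 2) / h - max 0 x) \<midarrow>0\<rightarrow> 0"
  proof (rule Lim_null_comparison[where g = "\<lambda>h. \<bar>h\<bar>"])
    have "norm (((max 0 (x + h))\<^sup>2 / 2 - (max 0 x)\<^sup>2 / 2) / h - max 0 x) \<le> \<bar>h\<bar>" if "h \<noteq> 0" for h
    proof -
      have "((max 0 (x + h))\<^sup>2 / 2 - (max 0 x)\<^sup>2 / 2) / h - max 0 x
          = ((max 0 (x + h))\<^sup>2 / 2 - (max 0 x)\<^sup>2 / 2 - max 0 x * h) / h"
        using that by (simp add: diff_divide_distrib)
      then have "norm (((max 0 (x + h))\<^sup>2 / 2 - (max 0 x)\<^sup>2 / 2) / h - max 0 x)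
          = \<bar>(max 0 (x + h))\<^sup>2 / 2 - (max 0 x)\<^sup>2 / 2 - max 0 x * h\<bar> / \<bar>h\<bar>"
        by (simp add: abs_divide)
      also have "\<dots> \<le> h\<^sup>2 / 2 / \<bar>h\<bar>"
        using bound[of "x + h"] by (intro divide_right_mono) auto
      also have "\<dots> \<le> \<bar>h\<bar>"
        using that by (simp add: power2_eq_square abs_if)
      finally show ?thesis .
    qed
    then show "\<forall>\<^sub>F h in at 0. norm (((max 0 (x + h))\<^sup>2 / 2 - (max 0 x)\<^sup>2 / 2) / h - max 0 x) \<le> \<bar>h\<bar>"
      by (auto simp: eventually_at_filter)
    show "(\<lambda>h. \<bar>h::real\<bar>) \<midarrow>0\<rightarrow> 0"
      by (rule tendsto_rabs_zero) (rule tendsto_ident_at)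
  qed
  then show ?thesis
    unfolding DERIV_def using Lim_null by blast
qed

definition tent :: "real \<Rightarrow> real \<Rightarrow> real" where
  "tent d x = max 0 (x + d) - 2 * max 0 x + max 0 (x - d)"

definition tent_prim :: "real \<Rightarrow> real \<Rightarrow> real" where
  "tent_prim d x = (max 0 (x + d))\<^sup>2 / 2 - 2 * ((max 0 x)\<^sup>2 / 2) + (max 0 (x - d))\<^sup>2 / 2"

lemma DERIV_tent_prim: "((\<lambda>t. tent_prim d (t - a)) has_real_derivative tent d (t - a)) (at t)"
proof -
  have *: "((\<lambda>t. (max 0 (f t))\<^sup>2 / 2) has_real_derivative max 0 (f t)) (at t)"
    if "(f has_real_derivative 1) (at t)" for f :: "real \<Rightarrow> real"
    using DERIV_chain2[OF DERIV_max0_square that] by simp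
  show ?thesis
    unfolding tent_prim_def tent_def
    by (intro DERIV_add DERIV_diff DERIV_cmult *) (auto intro!: derivative_eq_intros)
qed

lemma tent_simps:
  assumes "0 < d"
  shows "0 \<le> tent d x" "d \<le> \<bar>x\<bar> \<Longrightarrow> tent d x = 0" "tent d 0 = d"
    "x \<le> - d \<Longrightarrow> tent_prim d x = 0" "d \<le> x \<Longrightarrow> tent_prim d x = d\<^sup>2"
proof -
  show "d \<le> x \<Longrightarrow> tent_prim d x = d\<^sup>2"
    using assms by (simp add: tent_prim_def max_def power2_eq_square algebra_simps field_simps)
qed (use assms in \<open>auto simp: tent_def tent_prim_def max_def abs_if split: if_splits\<close>)

lemma continuous_on_tent: "continuous_on S (\<lambda>t. tent d (t - a))"
  unfolding tent_def by (intro continuous_intros)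

text \<open>A downward jump from \<open>a\<close> to \<open>b\<close> is detected by the test function whose derivative is a tent
  at \<open>a\<close> minus a tent at \<open>b\<close>.\<close>

lemma du_bois_reymond_aux:
  fixes h :: "real \<Rightarrow> real"
  assumes h: "continuous_on {0..T} h"
    and 0: "\<And>\<phi>. test_function T \<phi> \<Longrightarrow> (LINT t|time_measure T. deriv \<phi> t * h t) = 0"
    and ab: "0 < a" "a < b" "b < T"
  shows "h a \<le> h b"
proof (rule ccontr)
  assume "\<not> h a \<le> h b"
  define m where "m = (h a + h b) / 2"
  then have m: "m < h a" "h b < m" using \<open>\<not> h a \<le> h b\<close> by auto
  have "continuous_on {0<..<T} h" using h by (rule continuous_on_subset) auto
  then have "open ({0<..<T} \<inter> h -` {m<..})" "open ({0<..<T} \<inter> h -` {..<m})"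
    by (auto intro!: continuous_open_preimage)
  then obtain d1 d2 where d12: "0 < d1" "ball a d1 \<subseteq> {0<..<T} \<inter> h -` {m<..}"
      "0 < d2" "ball b d2 \<subseteq> {0<..<T} \<inter> h -` {..<m}"
    using ab m openE[of "{0<..<T} \<inter> h -` {m<..}" a] openE[of "{0<..<T} \<inter> h -` {..<m}" b]
    by (smt (verit) Int_iff greaterThanLessThan_iff greaterThan_iff lessThan_iff vimage_eq)
  define d where "d = min (min d1 d2) ((b - a) / 2) / 2"
  have d: "0 < d" "d < d1" "d < d2" "a + d < b - d"
    using d12 ab by (auto simp: d_def min_def field_simps)
  have above: "m < h t" "0 < t" "t < T" if "\<bar>t - a\<bar> \<le> d" for t
    using that d d12(2) by (auto simp: subset_iff dist_real_def)
  have below: "h t < m" "0 < t" "t < T" if "\<bar>t - b\<bar> \<le> d" for t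
    using that d d12(4) by (auto simp: subset_iff dist_real_def)
  define \<phi> where "\<phi> t = tent_prim d (t - a) - tent_prim d (t - b)" for t
  define \<psi> where "\<psi> t = tent d (t - a) - tent d (t - b)" for t
  have der: "(\<phi> has_real_derivative \<psi> t) (at t)" for t
    unfolding \<phi>_def \<psi>_def by (intro DERIV_diff DERIV_tent_prim)
  have cont: "continuous_on S \<psi>" for S
    unfolding \<psi>_def by (intro continuous_on_diff continuous_on_tent)
  have supp: "closure {t. \<phi> t \<noteq> 0} \<subseteq> {a - d..b + d}"
    using d tent_simps(4,5)[OF d(1)]
    by (intro closure_minimal subsetI) (auto simp: \<phi>_def intro: ccontr)
  have sub: "{a - d..b + d} \<subseteq> {0<..<T}"
    using above(2)[of "a - d"] below(3)[of "b + d"] d by auto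
  have "\<phi> C1_differentiable_on UNIV"
    using der cont by (auto simp: C1_differentiable_on_def has_real_derivative_iff_has_vector_derivative)
  moreover have "compact (closure {t. \<phi> t \<noteq> 0})"
    using supp by (metis closed_closure compact_Icc compact_Int_closed inf.absorb_iff2 inf_commute)
  ultimately have test: "test_function T \<phi>"
    using supp sub by (auto simp: test_function_def)
  have deriv: "deriv \<phi> = \<psi>"
    using der by (auto intro: DERIV_imp_deriv)
  have int: "integrable (time_measure T) \<psi>" "integrable (time_measure T) (\<lambda>t. \<psi> t * h t)"
    "integrable (time_measure T) (\<lambda>t. \<psi> t * (h t - m))"
    by (intro integrable_time_continuous continuous_intros cont h)+
  have "(LINT t|time_measure T. \<psi> t) = 0"
    using test_function_integral_deriv[OF _ test] ab deriv by simp
  then have "(LINT t|time_measure T. \<psi> t * (h t - m)) = 0"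
    using 0[OF test] int by (simp add: deriv right_diff_distrib)
  then have "integral {0..T} (\<lambda>t. \<psi> t * (h t - m)) = 0"
    using integral_time_eq_integral[OF int(3)] by simp
  moreover have "0 \<le> \<psi> t * (h t - m)" for t
  proof -
    consider "\<bar>t - a\<bar> < d" | "\<bar>t - b\<bar> < d" | "d \<le> \<bar>t - a\<bar>" "d \<le> \<bar>t - b\<bar>" by linarith
    then show ?thesis
    proof cases
      case 1
      then have "tent d (t - b) = 0" using d by (intro tent_simps(2)) auto
      then show ?thesis
        using above(1)[of t] 1 tent_simps(1)[OF d(1)] by (simp add: \<psi>_def)
    next
      case 2
      then have "tent d (t - a) = 0" using d by (intro tent_simps(2)) auto
      then show ?thesis
        using below(1)[of t] 2 tent_simps(1)[OF d(1), of "t - b"]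
        by (simp add: \<psi>_def mult_nonneg_nonpos)
    next
      case 3
      then show ?thesis using d by (simp add: \<psi>_def tent_simps)
    qed
  qed
  ultimately have "\<psi> a * (h a - m) = 0"
    using integral_eq_0_iff[of 0 T "\<lambda>t. \<psi> t * (h t - m)"] ab
    by (simp add: continuous_on_mult cont continuous_on_diff h)
  moreover have "\<psi> a = d"
    using d by (simp add: \<psi>_def tent_simps)
  ultimately show False using m d by simp
qed

lemma du_bois_reymond:
  fixes h :: "real \<Rightarrow> real"
  assumes T: "0 < T" and h: "continuous_on {0..T} h"
    and 0: "\<And>\<phi>. test_function T \<phi> \<Longrightarrow> (LINT t|time_measure T. deriv \<phi> t * h t) = 0"
    and t: "t \<in> {0..T}"
  shows "h t = h 0"
proof -
  have "h a = h b" if "0 < a" "a < b" "b < T" for a b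
  proof (rule antisym)
    show "h a \<le> h b"
      using du_bois_reymond_aux[OF h 0] that by blast
    show "h b \<le> h a"
      using du_bois_reymond_aux[of T "\<lambda>t. - h t" a b] h 0 that by (simp add: continuous_on_minus)
  qed
  note eq = this
  have c: "h s = h (T / 2)" if "s \<in> {0<..<T}" for s
  proof (cases s "T / 2" rule: linorder_cases)
    case less
    show ?thesis by (rule eq) (use that less T in auto)
  next
    case greater
    show ?thesis by (rule eq[symmetric]) (use that greater T in auto)
  qed (rule arg_cong)
  have eq_cl: "h s = h (T / 2)" if "s \<in> closure {0<..<T}" for s
  proof (rule continuous_constant_on_closure[OF _ c that])
    show "continuous_on (closure {0<..<T}) h" using h T by simp
  qed
  show ?thesis
    by (rule trans[OF eq_cl eq_cl[symmetric]]) (use t T in simp_all)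
qed

subsection \<open>Integral equations\<close>

lemma time_integral_exp:
  assumes "t \<in> {0..T}" "0 < K"
  shows "time_integral T (\<lambda>s. K * exp (2 * K * s) * m) t = m * (exp (2 * K * t) - 1) / 2"
proof -
  have "((\<lambda>s. m * exp (2 * K * s) / 2) has_real_derivative K * exp (2 * K * s) * m) (at s)" for s
    by (auto intro!: derivative_eq_intros)
  from time_integral_FTC[OF assms(1) this] show ?thesis
    by (simp add: continuous_intros algebra_simps diff_divide_distrib)
qed

text \<open>The contraction is measured in the weighted norm \<open>sup exp(-2Kt)|y(t)|\<close>.\<close>

lemma integral_equation_exists:
  fixes G :: "real \<Rightarrow> 'x::{banach,second_countable_topology} \<Rightarrow> 'x"
  assumes T: "0 < T" and K: "0 < K"
    and integ: "\<And>z. continuous_on {0..T} z \<Longrightarrow> integrable (time_measure T) (\<lambda>s. G s (z s))"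
    and lip: "AE s in time_measure T. \<forall>x y. norm (G s x - G s y) \<le> K * norm (x - y)"
  shows "\<exists>y. continuous_on {0..T} y \<and> (\<forall>t\<in>{0..T}. y t = x0 + time_integral T (\<lambda>s. G s (y s)) t)"
proof -
  define c where "c t = max 0 (min T t)" for t
  have c: "c t \<in> {0..T}" "t \<in> {0..T} \<Longrightarrow> c t = t" for t
    using T by (auto simp: c_def)
  define Y where "Y z s = exp (2 * K * s) *\<^sub>R apply_bcontfun z s" for z :: "real \<Rightarrow>\<^sub>C 'x" and s
  have contY: "continuous_on S (Y z)" for S z
    unfolding Y_def by (intro continuous_intros) auto
  define F where "F z t = exp (- (2 * K * t)) *\<^sub>R (x0 + time_integral T (\<lambda>s. G s (Y z s)) t)" for z t
  have contF: "continuous_on S (F z)" for S z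
    unfolding F_def by (intro continuous_intros continuous_on_time_integral integ contY)
  have bc: "(\<lambda>t. F z (c t)) \<in> bcontfun" for z
  proof -
    obtain b where "\<And>t. t \<in> {0..T} \<Longrightarrow> norm (F z t) \<le> b"
      using bounded_on_Icc[OF contF] by blast
    moreover have "continuous_on UNIV (\<lambda>t. F z (c t))"
      unfolding c_def by (rule continuous_on_compose2[OF contF[of UNIV]]) (auto intro!: continuous_intros)
    ultimately show ?thesis using c(1) by (intro bcontfun_normI) auto
  qed
  define \<Phi> where "\<Phi> z = Bcontfun (\<lambda>t. F z (c t))" for z
  have \<Phi>: "apply_bcontfun (\<Phi> z) t = F z (c t)" for z t
    by (simp add: \<Phi>_def Bcontfun_inverse bc)
  have "dist (\<Phi> z) (\<Phi> w) \<le> 1 / 2 * dist z w" for z w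
  proof (rule dist_bound)
    fix t0
    define t where "t = c t0"
    have t: "t \<in> {0..T}" using c by (simp add: t_def)
    define d where "d = dist z w"
    have "norm (time_integral T (\<lambda>s. G s (Y z s) - G s (Y w s)) t)
        \<le> time_integral T (\<lambda>s. K * exp (2 * K * s) * d) t"
    proof (rule norm_time_integral_le)
      show "AE s in time_measure T. s \<le> t \<longrightarrow> norm (G s (Y z s) - G s (Y w s)) \<le> K * exp (2 * K * s) * d"
        using lip
      proof eventually_elim
        case (elim s)
        have "norm (Y z s - Y w s) = exp (2 * K * s) * dist (apply_bcontfun z s) (apply_bcontfun w s)"
          by (simp add: Y_def dist_norm flip: scaleR_diff_right)
        also have "\<dots> \<le> exp (2 * K * s) * d"
          using dist_bounded[of z s w] by (simp add: d_def)
        finally have "K * norm (Y z s - Y w s) \<le> K * (exp (2 * K * s) * d)"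
          using K by simp
        then show ?case using elim[rule_format, of "Y z s" "Y w s"] by simp
      qed
    qed (use K in \<open>auto simp: d_def intro!: integrable_time_continuous continuous_intros\<close>)
    also have "\<dots> = d * (exp (2 * K * t) - 1) / 2"
      by (rule time_integral_exp[OF t K])
    finally have le: "norm (time_integral T (\<lambda>s. G s (Y z s) - G s (Y w s)) t) \<le> d * (exp (2 * K * t) - 1) / 2" .
    have "dist (apply_bcontfun (\<Phi> z) t0) (apply_bcontfun (\<Phi> w) t0)
        = exp (- (2 * K * t)) * norm (time_integral T (\<lambda>s. G s (Y z s) - G s (Y w s)) t)"
      by (simp add: \<Phi> t_def[symmetric] F_def dist_norm time_integral_diff integ contY flip: scaleR_diff_right)
    also have "\<dots> \<le> exp (- (2 * K * t)) * (d * (exp (2 * K * t) - 1) / 2)"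
      using le by simp
    also have "\<dots> = d * (1 - exp (- (2 * K * t))) / 2"
      by (simp add: algebra_simps flip: exp_add)
    also have "\<dots> \<le> 1 / 2 * d"
      by (simp add: d_def mult_left_le)
    finally show "dist (apply_bcontfun (\<Phi> z) t0) (apply_bcontfun (\<Phi> w) t0) \<le> 1 / 2 * dist z w"
      by (simp add: d_def)
  qed
  then obtain z where z: "\<Phi> z = z"
    using banach_fix_type[of "1/2" \<Phi>] by auto
  have "Y z t = x0 + time_integral T (\<lambda>s. G s (Y z s)) t" if "t \<in> {0..T}" for t
  proof -
    have "apply_bcontfun z t = F z t"
      using \<Phi>[of z t] z c(2)[OF that] by simp
    then have "Y z t = exp (2 * K * t) *\<^sub>R F z t"
      by (simp add: Y_def)
    also have "\<dots> = x0 + time_integral T (\<lambda>s. G s (Y z s)) t"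
      by (simp add: F_def flip: exp_add)
    finally show ?thesis .
  qed
  then show ?thesis using contY by blast
qed

lemma integral_equation_zero:
  fixes d g :: "real \<Rightarrow> 'x::{banach,second_countable_topology}"
  assumes T: "0 < T" and K: "0 < K" and d: "continuous_on {0..T} d"
    and eq: "\<And>t. t \<in> {0..T} \<Longrightarrow> d t = time_integral T g t"
    and g: "AE s in time_measure T. norm (g s) \<le> K * norm (d s)"
    and t: "t \<in> {0..T}"
  shows "d t = 0"
proof -
  have cont: "continuous_on {0..T} (\<lambda>t. exp (- (2 * K * t)) * norm (d t))"
    by (intro continuous_intros d)
  then obtain t0 where t0: "t0 \<in> {0..T}"
      "\<And>t. t \<in> {0..T} \<Longrightarrow> exp (- (2 * K * t)) * norm (d t) \<le> exp (- (2 * K * t0)) * norm (d t0)"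
    using continuous_attains_sup[OF compact_Icc _ cont] T by auto
  define m where "m = exp (- (2 * K * t0)) * norm (d t0)"
  have d_le: "norm (d t) \<le> exp (2 * K * t) * m" if "t \<in> {0..T}" for t
    using t0(2)[OF that] by (simp add: m_def exp_minus field_simps)
  have "norm (d t0) \<le> time_integral T (\<lambda>s. K * exp (2 * K * s) * m) t0"
    unfolding eq[OF t0(1)]
  proof (rule norm_time_integral_le)
    have "AE s in time_measure T. s \<in> {0..T}" by (rule AE_I2) auto
    then show "AE s in time_measure T. s \<le> t0 \<longrightarrow> norm (g s) \<le> K * exp (2 * K * s) * m"
      using g
    proof eventually_elim
      case (elim s)
      then show ?case
        using d_le[of s] K by (smt (verit) mult.assoc mult_left_mono)
    qed
  qed (use K in \<open>auto simp: m_def intro!: integrable_time_continuous continuous_intros\<close>)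
  also have "\<dots> = m * (exp (2 * K * t0) - 1) / 2"
    by (rule time_integral_exp[OF t0(1) K])
  finally have "m \<le> exp (- (2 * K * t0)) * (m * (exp (2 * K * t0) - 1) / 2)"
    by (simp add: m_def)
  also have "\<dots> = m * (1 - exp (- (2 * K * t0))) / 2"
    by (simp add: algebra_simps flip: exp_add)
  also have "\<dots> \<le> m / 2"
    by (simp add: m_def mult_left_le)
  finally have "m \<le> 0" by simp
  then show ?thesis
    using d_le[OF t] by (smt (verit) exp_ge_zero mult_nonneg_nonpos norm_le_zero_iff)
qed

subsection \<open>Square-integrable functions\<close>

lemma time_integral_bounded_linear:
  assumes "bounded_linear h" "integrable (time_measure T) g"
  shows "h (time_integral T g t) = time_integral T (\<lambda>s. h (g s)) t"
  using integral_bounded_linear[OF assms(1) integrable_time_indicator[OF assms(2)], of t]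
  by (simp add: time_integral_def linear_simps[OF assms(1)])

lemma integrable_square_bound:
  assumes f: "(\<lambda>t. norm (f t)) \<in> borel_measurable (time_measure T)"
    and u: "u \<in> L2 T S"
    and le: "AE t in time_measure T. norm (f t) \<le> L * norm (u t) + c"
  shows "integrable (time_measure T) (\<lambda>t. (norm (f t))\<^sup>2)"
proof (rule Bochner_Integration.integrable_bound)
  show "integrable (time_measure T) (\<lambda>t. 2 * L\<^sup>2 * (norm (u t))\<^sup>2 + 2 * c\<^sup>2)"
    using u by (auto simp: L2_def intro!: finite_measure.integrable_const[OF finite_measure_time])
  show "AE t in time_measure T. norm ((norm (f t))\<^sup>2) \<le> norm (2 * L\<^sup>2 * (norm (u t))\<^sup>2 + 2 * c\<^sup>2)"
    using le
  proof eventually_elim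
    case (elim t)
    then have "(norm (f t))\<^sup>2 \<le> (L * norm (u t) + c)\<^sup>2"
      by (intro power_mono) auto
    also have "\<dots> \<le> 2 * L\<^sup>2 * (norm (u t))\<^sup>2 + 2 * c\<^sup>2"
      using zero_le_power2[of "L * norm (u t) - c"] by (simp add: power2_eq_square algebra_simps)
    finally show ?case by simp
  qed
qed (use f in measurable)

lemma L2_bound:
  assumes "f \<in> borel_measurable (time_measure T)" "u \<in> L2 T S"
    and "AE t in time_measure T. norm (f t) \<le> L * norm (u t) + c"
  shows "f \<in> L2 T UNIV"
  using assms integrable_square_bound[OF _ assms(2,3)]
  by (auto simp: L2_def intro: measurable_compose[OF _ borel_measurable_norm])

lemma L2_mono: "f \<in> L2 T S \<Longrightarrow> S \<subseteq> S' \<Longrightarrow> f \<in> L2 T S'"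
  by (auto simp: L2_def)

lemma L2_integrable:
  fixes f :: "real \<Rightarrow> 'a::{banach,second_countable_topology}"
  assumes "f \<in> L2 T S"
  shows "integrable (time_measure T) f"
proof (rule Bochner_Integration.integrable_bound)
  show "integrable (time_measure T) (\<lambda>t. 1 + (norm (f t))\<^sup>2)"
    using assms by (auto simp: L2_def intro!: finite_measure.integrable_const[OF finite_measure_time])
  have "norm (f t) \<le> 1 + (norm (f t))\<^sup>2" for t
  proof -
    have "2 * norm (f t) \<le> 1 + (norm (f t))\<^sup>2"
      using sum_squares_bound[of 1 "norm (f t)"] by simp
    then show ?thesis
      using norm_ge_zero[of "f t"] by linarith
  qed
  then show "AE t in time_measure T. norm (f t) \<le> norm (1 + (norm (f t))\<^sup>2)"
    by (auto intro!: AE_I2)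
qed (use assms in \<open>auto simp: L2_def\<close>)

lemma L2_continuous:
  assumes f: "continuous_on {0..T} f" and S: "f ` {0..T} \<subseteq> S"
  shows "f \<in> L2 T S"
proof -
  obtain b where b: "\<And>t. t \<in> {0..T} \<Longrightarrow> norm (f t) \<le> b"
    using bounded_on_Icc[OF f] by blast
  have "(\<lambda>_. 0 :: real) \<in> L2 T UNIV"
    by (simp add: L2_def)
  then have "f \<in> L2 T UNIV"
    using b by (intro L2_bound[where L = 1 and c = b and u = "\<lambda>_. 0 :: real"] measurable_time_continuous f AE_I2) auto
  then show ?thesis
    using S by (auto simp: L2_def intro!: AE_I2)
qed

subsection \<open>The reduced state equation\<close>

text \<open>\<open>E\<close> is a basis of \<open>Vr\<close> that is orthonormal in \<open>H\<close>. Testing with it turns the equation in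
  \<open>Vr'\<close> into the ordinary differential equation \<open>y' = rhs u t y\<close> with values in \<open>Vr\<close>.\<close>

locale galerkin =
  fixes T :: real
    and \<iota> :: "'v::{real_inner,banach,second_countable_topology} \<Rightarrow>\<^sub>L 'h::real_inner"
    and A :: "real \<Rightarrow> 'v \<Rightarrow>\<^sub>L 'v \<Rightarrow>\<^sub>L real"
    and B :: "'u::real_inner \<Rightarrow>\<^sub>L 'v \<Rightarrow>\<^sub>L real"
    and Vr E :: "'v set"
  assumes T: "0 < T"
    and A: "A \<in> Linf_dual_ops T"
    and Vr: "subspace Vr"
    and finE: "finite E"
    and E_sub: "E \<subseteq> Vr"
    and orthonormal: "\<And>e f. e \<in> E \<Longrightarrow> f \<in> E \<Longrightarrow> \<iota> e \<bullet> \<iota> f = (if e = f then 1 else 0)"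
    and expand: "\<And>w. w \<in> Vr \<Longrightarrow> (\<Sum>e\<in>E. (\<iota> w \<bullet> \<iota> e) *\<^sub>R e) = w"
begin

definition rhs :: "(real \<Rightarrow> 'u) \<Rightarrow> real \<Rightarrow> 'v \<Rightarrow> 'v" where
  "rhs u t x = (\<Sum>e\<in>E. (B (u t) e - A t x e) *\<^sub>R e)"

definition lift :: "'v \<Rightarrow> 'v \<Rightarrow>\<^sub>L real" where
  "lift x = riesz (\<iota> x) o\<^sub>L \<iota>"

lemma lift_apply: "lift x w = \<iota> x \<bullet> \<iota> w"
  by (simp add: lift_def)

lemma functional_expand:
  fixes F :: "'v \<Rightarrow>\<^sub>L real"
  assumes "w \<in> Vr"
  shows "F w = (\<Sum>e\<in>E. F e * (\<iota> e \<bullet> \<iota> w))"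
  by (subst expand[OF assms, symmetric])
    (simp add: blinfun.sum_right blinfun.scaleR_right inner_commute mult.commute)

lemma lift_rhs:
  assumes "w \<in> Vr"
  shows "lift (rhs u t x) w = B (u t) w - A t x w"
proof -
  have "lift (rhs u t x) w = (\<Sum>e\<in>E. (B (u t) e - A t x e) * (\<iota> e \<bullet> \<iota> w))"
    by (simp add: lift_apply rhs_def blinfun.sum_right blinfun.scaleR_right inner_sum_left)
  then show ?thesis
    using functional_expand[OF assms, of "B (u t)"] functional_expand[OF assms, of "A t x"]
    by (simp add: left_diff_distrib sum_subtractf)
qed

lemma H_proj_in: "H_proj \<iota> Vr h \<in> Vr"
proof -
  have "\<exists>!w. w \<in> Vr \<and> (\<forall>z\<in>Vr. (h - \<iota> w) \<bullet> \<iota> z = 0)"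
  proof (rule ex_ex1I)
    define w where "w = (\<Sum>e\<in>E. (h \<bullet> \<iota> e) *\<^sub>R e)"
    have "w \<in> Vr"
      unfolding w_def using E_sub by (intro subspace_sum[OF Vr] subspace_scale[OF Vr]) auto
    moreover have e: "(h - \<iota> w) \<bullet> \<iota> e = 0" if "e \<in> E" for e
    proof -
      have "\<iota> w \<bullet> \<iota> e = (\<Sum>f\<in>E. if f = e then h \<bullet> \<iota> f else 0)"
        unfolding w_def blinfun.sum_right inner_sum_left
        using orthonormal that by (intro sum.cong) (auto simp: blinfun.scaleR_right)
      then show ?thesis
        using finE that by (simp add: inner_diff_left)
    qed
    moreover have "(h - \<iota> w) \<bullet> \<iota> z = 0" if "z \<in> Vr" for z
      by (subst expand[OF that, symmetric])
        (simp add: blinfun.sum_right blinfun.scaleR_right inner_sum_right e)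
    ultimately show "\<exists>w. w \<in> Vr \<and> (\<forall>z\<in>Vr. (h - \<iota> w) \<bullet> \<iota> z = 0)" by blast
  next
    fix w w'
    assume *: "w \<in> Vr \<and> (\<forall>z\<in>Vr. (h - \<iota> w) \<bullet> \<iota> z = 0)" "w' \<in> Vr \<and> (\<forall>z\<in>Vr. (h - \<iota> w') \<bullet> \<iota> z = 0)"
    have "\<iota> w \<bullet> \<iota> e = \<iota> w' \<bullet> \<iota> e" if "e \<in> E" for e
    proof -
      have "(h - \<iota> w) \<bullet> \<iota> e = 0" "(h - \<iota> w') \<bullet> \<iota> e = 0"
        using * that E_sub by blast+
      then show ?thesis by (simp add: inner_diff_left)
    qed
    then have "(\<Sum>e\<in>E. (\<iota> w \<bullet> \<iota> e) *\<^sub>R e) = (\<Sum>e\<in>E. (\<iota> w' \<bullet> \<iota> e) *\<^sub>R e)"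
      by simp
    then show "w = w'"
      using expand[OF conjunct1[OF *(1)]] expand[OF conjunct1[OF *(2)]] by simp
  qed
  from theI'[OF this] show ?thesis
    unfolding H_proj_def by blast
qed

lemma rhs_lipschitz:
  "\<exists>K>0. \<forall>u. AE t in time_measure T. \<forall>x y. norm (rhs u t x - rhs u t y) \<le> K * norm (x - y)"
proof -
  obtain M where M: "AE t in time_measure T. norm (A t) \<le> M"
    using A by (auto simp: Linf_dual_ops_def ess_bounded_def)
  define K where "K = (\<Sum>e\<in>E. \<bar>M\<bar> * (norm e)\<^sup>2) + 1"
  have "0 < K"
    unfolding K_def by (intro add_nonneg_pos sum_nonneg) auto
  moreover have "AE t in time_measure T. \<forall>x y. norm (rhs u t x - rhs u t y) \<le> K * norm (x - y)" for u
    using M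
  proof eventually_elim
    case (elim t)
    show ?case
    proof (intro allI)
      fix x y
      have "rhs u t x - rhs u t y = (\<Sum>e\<in>E. A t (y - x) e *\<^sub>R e)"
        by (simp add: rhs_def blinfun.diff_right blinfun.diff_left flip: sum_subtractf scaleR_diff_left)
      also have "norm \<dots> \<le> (\<Sum>e\<in>E. \<bar>M\<bar> * (norm e)\<^sup>2 * norm (x - y))"
      proof (rule sum_norm_le)
        fix e
        have "\<bar>A t (y - x) e\<bar> \<le> norm (A t (y - x)) * norm e"
          using norm_blinfun[of "A t (y - x)" e] by simp
        also have "\<dots> \<le> norm (A t) * norm (y - x) * norm e"
          by (intro mult_right_mono norm_blinfun) simp
        also have "\<dots> \<le> \<bar>M\<bar> * norm (y - x) * norm e"
          using elim by (intro mult_right_mono) auto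
        finally have "\<bar>A t (y - x) e\<bar> * norm e \<le> \<bar>M\<bar> * norm (y - x) * norm e * norm e"
          by (intro mult_right_mono) auto
        then show "norm (A t (y - x) e *\<^sub>R e) \<le> \<bar>M\<bar> * (norm e)\<^sup>2 * norm (x - y)"
          by (simp add: power2_eq_square norm_minus_commute mult_ac)
      qed
      also have "\<dots> \<le> K * norm (x - y)"
        by (simp add: K_def sum_distrib_right distrib_right)
      finally show "norm (rhs u t x - rhs u t y) \<le> K * norm (x - y)" .
    qed
  qed
  ultimately show ?thesis by blast
qed

lemma rhs_L2:
  assumes u: "u \<in> L2 T UNIV" and z: "continuous_on {0..T} z"
  shows "(\<lambda>t. rhs u t (z t)) \<in> L2 T UNIV"
proof -
  obtain K where K: "0 < K" "AE t in time_measure T. \<forall>x y. norm (rhs u t x - rhs u t y) \<le> K * norm (x - y)"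
    using rhs_lipschitz by blast
  obtain b where b: "\<And>t. t \<in> {0..T} \<Longrightarrow> norm (z t) \<le> b" "0 < b"
    using bounded_on_Icc[OF z] by blast
  define L where "L = (\<Sum>e\<in>E. norm B * (norm e)\<^sup>2)"
  have rhs0: "norm (rhs u t 0) \<le> L * norm (u t)" for t
  proof -
    have "norm (rhs u t 0) \<le> (\<Sum>e\<in>E. norm B * (norm e)\<^sup>2 * norm (u t))"
      unfolding rhs_def
    proof (rule sum_norm_le)
      fix e
      have "\<bar>B (u t) e\<bar> \<le> norm (B (u t)) * norm e"
        using norm_blinfun[of "B (u t)" e] by simp
      also have "\<dots> \<le> norm B * norm (u t) * norm e"
        by (intro mult_right_mono norm_blinfun) simp
      finally have "\<bar>B (u t) e\<bar> * norm e \<le> norm B * norm (u t) * norm e * norm e"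
        by (intro mult_right_mono) auto
      then show "norm ((B (u t) e - A t 0 e) *\<^sub>R e) \<le> norm B * (norm e)\<^sup>2 * norm (u t)"
        by (simp add: power2_eq_square mult_ac)
    qed
    then show ?thesis by (simp add: L_def sum_distrib_right)
  qed
  have AEin: "AE t in time_measure T. t \<in> {0..T}" by (rule AE_I2) auto
  show ?thesis
  proof (rule L2_bound[OF _ u])
    have "(\<lambda>t. B (u t) e) \<in> borel_measurable (time_measure T)" for e
    proof (rule measurable_compose[of u _ borel])
      show "(\<lambda>x. B x e) \<in> borel_measurable borel"
        by (intro borel_measurable_continuous_onI continuous_intros)
    qed (use u in \<open>auto simp: L2_def\<close>)
    moreover have "(\<lambda>t. A t (z t) e) \<in> borel_measurable (time_measure T)" for e
    proof (rule borel_measurable_caratheodory[where F = "\<lambda>t x. A t x e"])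
      show "(\<lambda>t. A t x e) \<in> borel_measurable (time_measure T)" for x
        using A by (simp add: Linf_dual_ops_def)
    qed (auto intro!: continuous_intros measurable_time_continuous z)
    ultimately show "(\<lambda>t. rhs u t (z t)) \<in> borel_measurable (time_measure T)"
      unfolding rhs_def by (intro borel_measurable_sum borel_measurable_scaleR borel_measurable_diff) auto
    show "AE t in time_measure T. norm (rhs u t (z t)) \<le> L * norm (u t) + K * b"
      using K(2) AEin
    proof eventually_elim
      case (elim t)
      have "norm (rhs u t (z t)) \<le> norm (rhs u t 0) + norm (rhs u t (z t) - rhs u t 0)"
        by (rule norm_triangle_sub)
      also have "\<dots> \<le> L * norm (u t) + K * norm (z t)"
        using rhs0[of t] elim(1)[rule_format, of "z t" 0] by simp
      also have "\<dots> \<le> L * norm (u t) + K * b"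
        using b(1)[OF elim(2)] K(1) by simp
      finally show ?case .
    qed
  qed
qed

lemma rhs_coeff_integrable:
  assumes "u \<in> L2 T UNIV" "continuous_on {0..T} z" "w \<in> Vr"
  shows "integrable (time_measure T) (\<lambda>t. B (u t) w - A t (z t) w)"
proof -
  have "integrable (time_measure T) (\<lambda>t. \<iota> (rhs u t (z t)) \<bullet> \<iota> w)"
    by (rule integrable_bounded_linear[OF _ L2_integrable[OF rhs_L2[OF assms(1,2)]]])
      (intro bounded_linear_intros)
  then show ?thesis
    using lift_rhs[OF assms(3)] by (simp add: lift_apply)
qed

definition mild :: "(real \<Rightarrow> 'u) \<Rightarrow> 'v \<Rightarrow> (real \<Rightarrow> 'v) \<Rightarrow> bool" where
  "mild u x0 y \<longleftrightarrow> continuous_on {0..T} y \<and>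
     (\<forall>t\<in>{0..T}. y t = x0 + time_integral T (\<lambda>s. rhs u s (y s)) t)"

lemma mild_exists:
  assumes "u \<in> L2 T UNIV"
  shows "\<exists>y. mild u x0 y"
proof -
  obtain K where "0 < K" "AE t in time_measure T. \<forall>x y. norm (rhs u t x - rhs u t y) \<le> K * norm (x - y)"
    using rhs_lipschitz by blast
  then show ?thesis
    unfolding mild_def using T by (intro integral_equation_exists L2_integrable[OF rhs_L2] assms)
qed

lemma mild_midpoint:
  assumes u: "u1 \<in> L2 T UNIV" "u2 \<in> L2 T UNIV" "u \<in> L2 T UNIV"
    and mid: "\<And>t. u t = (1/2) *\<^sub>R (u1 t + u2 t)"
    and m: "mild u1 x0 y1" "mild u2 x0 y2" "mild u x0 y" and t: "t \<in> {0..T}"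
  shows "y t = (1/2) *\<^sub>R (y1 t + y2 t)"
proof -
  obtain K where K: "0 < K" "AE t in time_measure T. \<forall>x y. norm (rhs u t x - rhs u t y) \<le> K * norm (x - y)"
    using rhs_lipschitz by blast
  have cont: "continuous_on {0..T} y1" "continuous_on {0..T} y2" "continuous_on {0..T} y"
    using m by (auto simp: mild_def)
  note int = L2_integrable[OF rhs_L2[OF u(1) cont(1)]] L2_integrable[OF rhs_L2[OF u(2) cont(2)]]
    L2_integrable[OF rhs_L2[OF u(3) cont(3)]]
  define d where "d t = y t - (1/2) *\<^sub>R (y1 t + y2 t)" for t
  define g where "g t = rhs u t (y t) - (1/2) *\<^sub>R (rhs u1 t (y1 t) + rhs u2 t (y2 t))" for t
  have "rhs u t ((1/2) *\<^sub>R (x1 + x2)) = (1/2) *\<^sub>R (rhs u1 t x1 + rhs u2 t x2)" for t x1 x2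
    unfolding rhs_def mid scaleR_sum_right sum.distrib[symmetric]
    by (intro sum.cong) (auto simp: blinfun.scaleR_right blinfun.scaleR_left blinfun.add_right
        blinfun.add_left algebra_simps simp flip: scaleR_add_left scaleR_diff_left)
  then have g: "g t = rhs u t (y t) - rhs u t ((1/2) *\<^sub>R (y1 t + y2 t))" for t
    by (simp add: g_def)
  have "d t = 0"
  proof (rule integral_equation_zero[OF T K(1) _ _ _ t])
    show "continuous_on {0..T} d"
      unfolding d_def by (intro continuous_intros cont)
    show "AE s in time_measure T. norm (g s) \<le> K * norm (d s)"
      using K(2) by eventually_elim (simp only: g d_def)
    fix t assume "t \<in> {0..T}"
    then have "y1 t = x0 + time_integral T (\<lambda>s. rhs u1 s (y1 s)) t"
      "y2 t = x0 + time_integral T (\<lambda>s. rhs u2 s (y2 s)) t"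
      "y t = x0 + time_integral T (\<lambda>s. rhs u s (y s)) t"
      using m by (auto simp: mild_def)
    moreover have "time_integral T g t = time_integral T (\<lambda>s. rhs u s (y s)) t
        - (1/2) *\<^sub>R (time_integral T (\<lambda>s. rhs u1 s (y1 s)) t + time_integral T (\<lambda>s. rhs u2 s (y2 s)) t)"
      unfolding g_def using int
      by (simp only: time_integral_diff time_integral_scaleR time_integral_add
          Bochner_Integration.integrable_add integrable_scaleR_right)
    moreover have "(1/2) *\<^sub>R (x0 + a + (x0 + b)) = x0 + (1/2) *\<^sub>R (a + b)" for a b
    proof -
      have "x0 + a + (x0 + b) = 2 *\<^sub>R x0 + (a + b)"
        by (simp add: scaleR_2)
      show ?thesis
        unfolding \<open>x0 + a + (x0 + b) = _\<close> by (simp add: scaleR_add_right)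
    qed
    ultimately show "d t = time_integral T g t"
      by (simp add: d_def)
  qed
  then show ?thesis by (simp add: d_def)
qed

lemma mild_imp_solves:
  assumes u: "u \<in> L2 T UNIV" and m: "mild u (H_proj \<iota> Vr y0) y"
  shows "solves_reduced_state T \<iota> A B y0 Vr u y"
proof -
  let ?x0 = "H_proj \<iota> Vr y0"
  have cont: "continuous_on {0..T} y"
    and eq: "\<And>t. t \<in> {0..T} \<Longrightarrow> y t = ?x0 + time_integral T (\<lambda>s. rhs u s (y s)) t"
    using m by (auto simp: mild_def)
  note L2 = rhs_L2[OF u cont]
  have coeff: "integrable (time_measure T) (\<lambda>t. B (u t) w - A t (y t) w)" if "w \<in> Vr" for w
    using rhs_coeff_integrable[OF u cont that] .
  have y_in: "y t \<in> Vr" if "t \<in> {0..T}" for t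
  proof -
    have "time_integral T (\<lambda>s. rhs u s (y s)) t
        = (\<Sum>e\<in>E. time_integral T (\<lambda>s. B (u s) e - A s (y s) e) t *\<^sub>R e)"
      unfolding rhs_def using coeff E_sub by (intro time_integral_sum_scaleR) auto
    also have "\<dots> \<in> Vr"
      using E_sub by (intro subspace_sum[OF Vr] subspace_scale[OF Vr]) auto
    finally show ?thesis
      using eq[OF that] H_proj_in subspace_add[OF Vr] by simp
  qed
  define dy where "dy t = lift (rhs u t (y t))" for t
  have lin: "bounded_linear lift"
    unfolding lift_def by (intro bounded_linear_intros)
  have "has_weak_time_deriv T \<iota> Vr y dy"
    unfolding has_weak_time_deriv_def
  proof (intro conjI allI impI ballI)
    obtain L where L: "\<And>x. norm (lift x) \<le> norm x * L"
      using bounded_linear.bounded[OF lin] by blast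
    show "dy \<in> L2 T UNIV"
    proof (rule L2_bound[OF _ L2])
      show "dy \<in> borel_measurable (time_measure T)"
        unfolding dy_def
      proof (rule measurable_compose[of "\<lambda>t. rhs u t (y t)" _ borel lift])
        show "lift \<in> borel_measurable borel"
          by (intro borel_measurable_continuous_onI linear_continuous_on lin)
      qed (use L2 in \<open>simp add: L2_def\<close>)
      show "AE t in time_measure T. norm (dy t) \<le> L * norm (rhs u t (y t)) + 0"
        using L by (simp add: dy_def mult.commute)
    qed
  next
    fix \<phi> w assume \<phi>: "test_function T \<phi>" and w: "w \<in> Vr"
    define g where "g t = dy t w" for t
    have g_eq: "g = (\<lambda>t. B (u t) w - A t (y t) w)"
      by (rule ext) (simp add: g_def dy_def lift_rhs[OF w])
    have g: "integrable (time_measure T) g"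
      unfolding g_eq by (rule coeff[OF w])
    have yw: "\<iota> (y t) \<bullet> \<iota> w = \<iota> ?x0 \<bullet> \<iota> w + time_integral T g t" if "t \<in> {0..T}" for t
    proof -
      have "bounded_linear (\<lambda>x. \<iota> x \<bullet> \<iota> w)" by (intro bounded_linear_intros)
      from time_integral_bounded_linear[OF this L2_integrable[OF L2]] show ?thesis
        using eq[OF that] by (simp add: blinfun.add_right inner_add_left g_def[abs_def] dy_def lift_apply)
    qed
    have "(LINT t|time_measure T. deriv \<phi> t * (\<iota> (y t) \<bullet> \<iota> w))
        = (LINT t|time_measure T. deriv \<phi> t * (\<iota> ?x0 \<bullet> \<iota> w) + deriv \<phi> t * time_integral T g t)"
      by (intro Bochner_Integration.integral_cong) (auto simp: yw distrib_left)
    also have "\<dots> = (LINT t|time_measure T. deriv \<phi> t * (\<iota> ?x0 \<bullet> \<iota> w))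
        + (LINT t|time_measure T. deriv \<phi> t * time_integral T g t)"
      by (intro Bochner_Integration.integral_add integrable_time_continuous continuous_intros
          test_functionD(2)[OF \<phi>] continuous_on_time_integral g)
    also have "\<dots> = - (LINT t|time_measure T. \<phi> t * g t)"
      using test_function_integral_deriv[OF T \<phi>] weak_derivative_time_integral[OF T \<phi> g] by simp
    finally show "(LINT t|time_measure T. deriv \<phi> t * (\<iota> (y t) \<bullet> \<iota> w))
        = - (LINT t|time_measure T. \<phi> t * dy t w)"
      by (simp add: g_def)
  qed
  moreover have "dy t w + A t (y t) w = B (u t) w" if "w \<in> Vr" for t w
    by (simp add: dy_def lift_rhs[OF that])
  moreover have "y 0 = ?x0"
    using eq[of 0] T by (simp add: time_integral_0)
  ultimately show ?thesis
    unfolding solves_reduced_state_def Wr_def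
    using cont y_in L2_continuous[OF cont, of Vr] by blast
qed

lemma solves_imp_mild:
  assumes u: "u \<in> L2 T UNIV" and s: "solves_reduced_state T \<iota> A B y0 Vr u y"
  shows "mild u (H_proj \<iota> Vr y0) y"
proof -
  have cont: "continuous_on {0..T} y" and y_in: "\<And>t. t \<in> {0..T} \<Longrightarrow> y t \<in> Vr"
    and init: "y 0 = H_proj \<iota> Vr y0"
    using s by (auto simp: solves_reduced_state_def Wr_def)
  obtain dy where dy: "has_weak_time_deriv T \<iota> Vr y dy"
      "AE t in time_measure T. \<forall>w\<in>Vr. dy t w + A t (y t) w = B (u t) w"
    using s by (auto simp: solves_reduced_state_def)
  have coeff: "\<iota> (y t) \<bullet> \<iota> w = \<iota> (y 0) \<bullet> \<iota> w + time_integral T (\<lambda>s. B (u s) w - A s (y s) w) t"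
    if w: "w \<in> Vr" and t: "t \<in> {0..T}" for w t
  proof -
    define g where "g t = dy t w" for t
    have dyL2: "dy \<in> L2 T UNIV"
      using dy(1) by (simp add: has_weak_time_deriv_def)
    have "g \<in> L2 T UNIV"
    proof (rule L2_bound[OF _ dyL2])
      show "g \<in> borel_measurable (time_measure T)"
        unfolding g_def
      proof (rule measurable_compose[of dy _ borel])
        show "(\<lambda>f. blinfun_apply f w) \<in> borel_measurable borel"
          by (intro borel_measurable_continuous_onI continuous_intros)
      qed (use dyL2 in \<open>simp add: L2_def\<close>)
      show "AE t in time_measure T. norm (g t) \<le> norm w * norm (dy t) + 0"
        using norm_blinfun[of "dy _" w] by (auto simp: g_def mult.commute[of "norm w"] intro!: AE_I2)
    qed
    then have g: "integrable (time_measure T) g" by (rule L2_integrable)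
    define h where "h t = \<iota> (y t) \<bullet> \<iota> w - time_integral T g t" for t
    have conth: "continuous_on {0..T} (\<lambda>t. \<iota> (y t) \<bullet> \<iota> w)"
      by (intro continuous_intros cont)
    have "h t = h 0"
    proof (rule du_bois_reymond[OF T _ _ t])
      show "continuous_on {0..T} h"
        unfolding h_def by (intro continuous_intros conth continuous_on_time_integral g)
    next
      fix \<phi> assume \<phi>: "test_function T \<phi>"
      have "(LINT t|time_measure T. deriv \<phi> t * h t)
          = (LINT t|time_measure T. deriv \<phi> t * (\<iota> (y t) \<bullet> \<iota> w))
          - (LINT t|time_measure T. deriv \<phi> t * time_integral T g t)"
        unfolding h_def right_diff_distrib
        by (intro Bochner_Integration.integral_diff integrable_time_continuous continuous_on_mult
            test_functionD(2)[OF \<phi>] conth continuous_on_time_integral g)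
      then show "(LINT t|time_measure T. deriv \<phi> t * h t) = 0"
        using dy(1) \<phi> w weak_derivative_time_integral[OF T \<phi> g]
        by (simp add: has_weak_time_deriv_def g_def)
    qed
    then have "\<iota> (y t) \<bullet> \<iota> w = \<iota> (y 0) \<bullet> \<iota> w + time_integral T g t"
      by (simp add: h_def time_integral_0)
    also have "time_integral T g t = time_integral T (\<lambda>s. B (u s) w - A s (y s) w) t"
    proof (rule time_integral_cong_AE)
      show "AE t in time_measure T. g t = B (u t) w - A t (y t) w"
        using dy(2) by eventually_elim (use w in \<open>auto simp: g_def eq_diff_eq\<close>)
    qed (use g rhs_coeff_integrable[OF u cont w] in auto)
    finally show ?thesis .
  qed
  have "y t = H_proj \<iota> Vr y0 + time_integral T (\<lambda>s. rhs u s (y s)) t" if t: "t \<in> {0..T}" for t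
  proof -
    have "y t = (\<Sum>e\<in>E. (\<iota> (y t) \<bullet> \<iota> e) *\<^sub>R e)"
      using expand[OF y_in[OF t]] by simp
    also have "\<dots> = (\<Sum>e\<in>E. (\<iota> (y 0) \<bullet> \<iota> e) *\<^sub>R e)
        + (\<Sum>e\<in>E. time_integral T (\<lambda>s. B (u s) e - A s (y s) e) t *\<^sub>R e)"
      unfolding sum.distrib[symmetric] using coeff[OF _ t] E_sub
      by (intro sum.cong) (auto simp: subset_iff simp flip: scaleR_add_left)
    also have "(\<Sum>e\<in>E. time_integral T (\<lambda>s. B (u s) e - A s (y s) e) t *\<^sub>R e)
        = time_integral T (\<lambda>s. rhs u s (y s)) t"
      unfolding rhs_def using rhs_coeff_integrable[OF u cont] E_sub
      by (intro time_integral_sum_scaleR[symmetric]) auto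
    also have "(\<Sum>e\<in>E. (\<iota> (y 0) \<bullet> \<iota> e) *\<^sub>R e) = H_proj \<iota> Vr y0"
      using expand[OF H_proj_in] by (simp add: init)
    finally show ?thesis .
  qed
  then show ?thesis using cont by (simp add: mild_def)
qed

lemma reduced_state_mild:
  assumes "u \<in> L2 T UNIV"
  shows "mild u (H_proj \<iota> Vr y0) (reduced_state T \<iota> A B y0 Vr u)"
proof -
  have "\<exists>y. solves_reduced_state T \<iota> A B y0 Vr u y"
    using mild_exists[OF assms] mild_imp_solves[OF assms] by blast
  then have "solves_reduced_state T \<iota> A B y0 Vr u (reduced_state T \<iota> A B y0 Vr u)"
    unfolding reduced_state_def by (rule someI_ex)
  then show ?thesis by (rule solves_imp_mild[OF assms])
qed

end

subsection \<open>Minimizers of the reduced cost\<close>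

lemma reduced_state_cong:
  fixes B :: "'u::real_inner \<Rightarrow>\<^sub>L 'v::real_inner \<Rightarrow>\<^sub>L real"
  assumes "AE t in time_measure T. \<forall>w\<in>Vr. B (u1 t) w = B (u2 t) w"
  shows "reduced_state T \<iota> A B y0 Vr u1 = reduced_state T \<iota> A B y0 Vr u2"
proof -
  have "(AE t in time_measure T. \<forall>w\<in>Vr. dy t w + A t (y t) w = B (u1 t) w)
      \<longleftrightarrow> (AE t in time_measure T. \<forall>w\<in>Vr. dy t w + A t (y t) w = B (u2 t) w)" for dy y
  proof
    assume "AE t in time_measure T. \<forall>w\<in>Vr. dy t w + A t (y t) w = B (u1 t) w"
    then show "AE t in time_measure T. \<forall>w\<in>Vr. dy t w + A t (y t) w = B (u2 t) w"
      using assms by eventually_elim simp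
  next
    assume "AE t in time_measure T. \<forall>w\<in>Vr. dy t w + A t (y t) w = B (u2 t) w"
    then show "AE t in time_measure T. \<forall>w\<in>Vr. dy t w + A t (y t) w = B (u1 t) w"
      using assms by eventually_elim simp
  qed
  then have "solves_reduced_state T \<iota> A B y0 Vr u1 = solves_reduced_state T \<iota> A B y0 Vr u2"
    by (intro ext) (simp only: solves_reduced_state_def)
  then show ?thesis by (simp add: reduced_state_def)
qed

lemma observation_integrable:
  fixes \<iota> :: "'v::{real_inner,banach,second_countable_topology}
              \<Rightarrow>\<^sub>L 'h::{real_inner,banach,second_countable_topology}"
  assumes C: "C \<in> Linf_ops T" and yd: "yd \<in> L2 T UNIV" and y: "continuous_on {0..T} y"
  shows "integrable (time_measure T) (\<lambda>t. (norm (C t (\<iota> (y t)) - yd t))\<^sup>2)"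
proof -
  obtain M where M: "AE t in time_measure T. norm (C t) \<le> M"
    using C by (auto simp: Linf_ops_def ess_bounded_def)
  have "continuous_on {0..T} (\<lambda>t. \<iota> (y t))"
    by (intro continuous_intros y)
  then obtain b where b: "\<And>t. t \<in> {0..T} \<Longrightarrow> norm (\<iota> (y t)) \<le> b" "0 < b"
    using bounded_on_Icc by blast
  have AEin: "AE t in time_measure T. t \<in> {0..T}" by (rule AE_I2) auto
  show ?thesis
  proof (rule integrable_square_bound[OF _ yd])
    show "(\<lambda>t. norm (C t (\<iota> (y t)) - yd t)) \<in> borel_measurable (time_measure T)"
    proof (rule borel_measurable_norm_weak)
      fix k
      have "(\<lambda>t. C t (\<iota> (y t)) \<bullet> k) \<in> borel_measurable (time_measure T)"
      proof (rule borel_measurable_caratheodory[where F = "\<lambda>t x. C t (\<iota> x) \<bullet> k"])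
        show "(\<lambda>t. C t (\<iota> x) \<bullet> k) \<in> borel_measurable (time_measure T)" for x
          using C by (simp add: Linf_ops_def)
      qed (auto intro!: continuous_intros measurable_time_continuous y)
      moreover have "(\<lambda>t. yd t \<bullet> k) \<in> borel_measurable (time_measure T)"
        using yd by (auto simp: L2_def)
      ultimately show "(\<lambda>t. (C t (\<iota> (y t)) - yd t) \<bullet> k) \<in> borel_measurable (time_measure T)"
        by (simp add: inner_diff_left)
    qed
    show "AE t in time_measure T. norm (C t (\<iota> (y t)) - yd t) \<le> 1 * norm (yd t) + \<bar>M\<bar> * b"
      using M AEin
    proof eventually_elim
      case (elim t)
      have "norm (C t (\<iota> (y t))) \<le> norm (C t) * norm (\<iota> (y t))"
        by (rule norm_blinfun)
      also have "\<dots> \<le> \<bar>M\<bar> * b"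
        using elim b by (intro mult_mono) auto
      finally show ?case
        using norm_triangle_ineq4[of "C t (\<iota> (y t))" "yd t"] by simp
    qed
  qed
qed

lemma norm_midpoint_square:
  fixes a b :: "'a::real_inner"
  shows "(norm ((1/2) *\<^sub>R (a + b)))\<^sup>2 = 1/2 * (norm a)\<^sup>2 + 1/2 * (norm b)\<^sup>2 - 1/4 * (norm (a - b))\<^sup>2"
  unfolding power2_norm_eq_inner
  by (simp add: inner_add_left inner_add_right inner_diff_left inner_diff_right inner_commute field_simps)

lemma L2_add_scaled:
  fixes f g :: "real \<Rightarrow> 'a::{real_inner,second_countable_topology}"
  assumes "f \<in> L2 T UNIV" "g \<in> L2 T UNIV" and ab: "\<bar>a\<bar> \<le> 1" "\<bar>b\<bar> \<le> 1"
  shows "(\<lambda>t. a *\<^sub>R f t + b *\<^sub>R g t) \<in> L2 T UNIV"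
proof -
  have [measurable]: "f \<in> borel_measurable (time_measure T)" "g \<in> borel_measurable (time_measure T)"
    using assms by (auto simp: L2_def)
  have "(norm (a *\<^sub>R x + b *\<^sub>R y))\<^sup>2 \<le> 2 * (norm x)\<^sup>2 + 2 * (norm y)\<^sup>2" for x y :: 'a
  proof -
    have "norm (a *\<^sub>R x + b *\<^sub>R y) \<le> norm x + norm y"
      using ab by (intro norm_triangle_mono) (auto intro: mult_left_le_one_le)
    then have "(norm (a *\<^sub>R x + b *\<^sub>R y))\<^sup>2 \<le> (norm x + norm y)\<^sup>2"
      by (intro power_mono) auto
    also have "\<dots> \<le> 2 * (norm x)\<^sup>2 + 2 * (norm y)\<^sup>2"
      using sum_squares_bound[of "norm x" "norm y"] by (simp add: power2_sum)
    finally show ?thesis .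
  qed
  then have le: "AE t in time_measure T. norm ((norm (a *\<^sub>R f t + b *\<^sub>R g t))\<^sup>2)
      \<le> norm (2 * (norm (f t))\<^sup>2 + 2 * (norm (g t))\<^sup>2)"
    by simp
  have "integrable (time_measure T) (\<lambda>t. 2 * (norm (f t))\<^sup>2 + 2 * (norm (g t))\<^sup>2)"
    using assms by (auto simp: L2_def)
  moreover have "(\<lambda>t. (norm (a *\<^sub>R f t + b *\<^sub>R g t))\<^sup>2) \<in> borel_measurable (time_measure T)"
    by measurable
  ultimately have "integrable (time_measure T) (\<lambda>t. (norm (a *\<^sub>R f t + b *\<^sub>R g t))\<^sup>2)"
    using le by (rule Bochner_Integration.integrable_bound)
  then show ?thesis by (simp add: L2_def)
qed

theorem lemma3:
  fixes \<iota> :: "'v::{real_inner,banach,second_countable_topology}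
              \<Rightarrow>\<^sub>L 'h::{real_inner,banach,second_countable_topology}"
    and A :: "real \<Rightarrow> 'v \<Rightarrow>\<^sub>L 'v \<Rightarrow>\<^sub>L real"
    and B :: "'u::{real_inner,banach,second_countable_topology} \<Rightarrow>\<^sub>L 'v \<Rightarrow>\<^sub>L real"
    and C :: "real \<Rightarrow> 'h \<Rightarrow>\<^sub>L 'h"
    and T \<eta> \<beta> :: real
    and yd :: "real \<Rightarrow> 'h" and y0 :: 'h
    and r :: nat and v :: "nat \<Rightarrow> 'v" and u :: "nat \<Rightarrow> 'u"
    and Vr :: "'v set" and Ur :: "'u set"
    and uhat ubar :: "real \<Rightarrow> 'u"
  assumes T: "T > 0"
    and embedding: "compact_dense_embedding \<iota>"
    and A_Linf: "A \<in> Linf_dual_ops T"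
    and eta: "\<eta> > 0"
    and A_coercive: "\<And>t w. t \<in> {0<..<T} \<Longrightarrow> A t w w \<ge> \<eta> * (norm w)\<^sup>2"
    and C_Linf: "C \<in> Linf_ops T"
    and beta: "\<beta> > 0"
    and yd: "yd \<in> L2 T UNIV"
    and Vr: "Vr = span (v ` {1..r})"
    and u: "\<And>i. i \<in> {1..r} \<Longrightarrow> u i = inv riesz (dual_op B (v i))"
    and Ur: "Ur = span (u ` {1..r})"
    and uhat: "is_arg_min (reduced_cost T \<iota> A B C \<beta> yd y0 Vr) (\<lambda>w. w \<in> L2 T UNIV) uhat"
    and ubar: "is_arg_min (reduced_cost T \<iota> A B C \<beta> yd y0 Vr) (\<lambda>w. w \<in> L2 T Ur) ubar"
  shows "(AE t in time_measure T. ubar t = uhat t) \<and>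
    (\<forall>t\<in>{0..T}. reduced_state T \<iota> A B y0 Vr ubar t = reduced_state T \<iota> A B y0 Vr uhat t) \<and>
    (\<forall>t\<in>{0..T}.
       reduced_adjoint_state T \<iota> A C yd Vr (\<lambda>s. \<iota> (reduced_state T \<iota> A B y0 Vr ubar s)) t =
       reduced_adjoint_state T \<iota> A C yd Vr (\<lambda>s. \<iota> (reduced_state T \<iota> A B y0 Vr uhat s)) t)"
proof -
  have subVr: "subspace Vr" using Vr by simp
  have inj\<iota>: "inj (blinfun_apply \<iota>)"
    using embedding by (simp add: compact_dense_embedding_def)
  obtain E where E: "finite E" "E \<subseteq> Vr"
      "\<And>e f. e \<in> E \<Longrightarrow> f \<in> E \<Longrightarrow> \<iota> e \<bullet> \<iota> f = (if e = f then 1 else 0)"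
      "\<And>w. w \<in> Vr \<Longrightarrow> (\<Sum>e\<in>E. (\<iota> w \<bullet> \<iota> e) *\<^sub>R e) = w"
    unfolding Vr using orthonormal_basis_pullback[OF inj\<iota>, of "v ` {1..r}"] by auto
  interpret G: galerkin T \<iota> A B Vr E
    by unfold_locales (use T A_Linf subVr E in auto)

  obtain F where F: "finite F" "F \<subseteq> Ur"
      "\<And>e f. e \<in> F \<Longrightarrow> f \<in> F \<Longrightarrow> e \<bullet> f = (if e = f then 1 else 0)"
      "\<And>w. w \<in> Ur \<Longrightarrow> (\<Sum>e\<in>F. (w \<bullet> e) *\<^sub>R e) = w"
    unfolding Ur using orthonormal_basis_pullback[of id_blinfun "u ` {1..r}"] by (auto simp: inj_def)
  define P where "P x = (\<Sum>f\<in>F. (x \<bullet> f) *\<^sub>R f)" for x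
  have P_in: "P x \<in> Ur" for x
    unfolding P_def Ur using F(2) Ur by (intro span_sum span_scale) auto
  have P_orth: "(x - P x) \<bullet> z = 0" if "z \<in> Ur" for x z
  proof -
    have f: "(x - P x) \<bullet> f = 0" if "f \<in> F" for f
    proof -
      have "P x \<bullet> f = (\<Sum>g\<in>F. if g = f then x \<bullet> g else 0)"
        unfolding P_def inner_sum_left using F(3) that by (intro sum.cong) auto
      then show ?thesis using F(1) that by (simp add: inner_diff_left)
    qed
    show ?thesis
      by (subst F(4)[OF that, symmetric]) (simp add: inner_sum_right f)
  qed
  have P_norm: "norm (P x) \<le> norm x" for x
  proof -
    have "norm (P x) * norm (P x) = x \<bullet> P x"
      using P_orth[OF P_in, of x x] by (simp add: inner_diff_left power2_norm_eq_inner[symmetric] power2_eq_square)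
    also have "\<dots> \<le> norm x * norm (P x)"
      by (rule norm_cauchy_schwarz)
    finally show ?thesis
      by (cases "P x = 0") auto
  qed
  have B_P: "B (P x) w = B x w" if "w \<in> Vr" for x w
  proof -
    have "B (x - P x) (v i) = 0" if i: "i \<in> {1..r}" for i
    proof -
      have "riesz (u i) = dual_op B (v i)"
        unfolding u[OF i] using riesz_representation[of "dual_op B (v i)"] by (metis f_inv_into_f rangeI)
      then have "B (x - P x) (v i) = u i \<bullet> (x - P x)"
        using dual_op_apply[of B "v i" "x - P x"] by (metis blinfun_inner_right.rep_eq)
      also have "u i \<in> Ur"
        unfolding Ur using i by (intro span_base) auto
      then have "u i \<bullet> (x - P x) = 0"
        using P_orth by (simp add: inner_commute)
      finally show ?thesis .
    qed
    then have "B (x - P x) w = 0"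
      using that unfolding Vr
      by (intro linear_eq_0_on_span[of "blinfun_apply (B (x - P x))" "v ` {1..r}" w])
        (auto intro: bounded_linear.linear blinfun.bounded_linear_right)
    then show ?thesis
      by (simp add: blinfun.diff_right blinfun.diff_left)
  qed

  let ?S = "reduced_state T \<iota> A B y0 Vr"
  let ?J = "reduced_cost T \<iota> A B C \<beta> yd y0 Vr"
  define D where "D w = (LINT t|time_measure T. (norm (C t (\<iota> (?S w t)) - yd t))\<^sup>2)" for w
  define N where "N w = (LINT t|time_measure T. (norm (w t))\<^sup>2)" for w :: "real \<Rightarrow> 'u"
  have intS: "integrable (time_measure T) (\<lambda>t. (norm (C t (\<iota> (?S w t)) - yd t))\<^sup>2)" if "w \<in> L2 T UNIV" for w
    using G.reduced_state_mild[OF that, of y0] by (intro observation_integrable C_Linf yd) (simp add: G.mild_def)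
  have intN: "integrable (time_measure T) (\<lambda>t. (norm (w t))\<^sup>2)" if "w \<in> L2 T UNIV" for w :: "real \<Rightarrow> 'u"
    using that by (simp add: L2_def)
  have J: "?J w = 1/2 * D w + \<beta>/2 * N w" if "w \<in> L2 T UNIV" for w
    unfolding reduced_cost_def D_def N_def using intS[OF that] intN[OF that] by simp

  have uhatL2: "uhat \<in> L2 T UNIV" and ubarL2: "ubar \<in> L2 T UNIV"
    using uhat ubar L2_mono[of ubar T Ur UNIV] by (auto simp: is_arg_min_def)
  define uP where "uP t = P (uhat t)" for t
  have uP: "uP \<in> L2 T Ur"
  proof -
    have "uP \<in> L2 T UNIV"
    proof (rule L2_bound[OF _ uhatL2])
      show "uP \<in> borel_measurable (time_measure T)"
        unfolding uP_def P_def using uhatL2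
        by (intro borel_measurable_sum borel_measurable_scaleR borel_measurable_inner) (auto simp: L2_def)
      show "AE t in time_measure T. norm (uP t) \<le> 1 * norm (uhat t) + 0"
        using P_norm by (simp add: uP_def)
    qed
    then show ?thesis using P_in by (simp add: L2_def uP_def)
  qed
  then have uPL2: "uP \<in> L2 T UNIV"
    by (rule L2_mono) simp
  have "?S uP = ?S uhat"
    using B_P by (intro reduced_state_cong) (simp add: uP_def)
  moreover have "N uP \<le> N uhat"
    unfolding N_def
  proof (rule integral_mono)
    show "(norm (uP t))\<^sup>2 \<le> (norm (uhat t))\<^sup>2" for t
      using P_norm[of "uhat t"] by (simp add: uP_def power_mono)
  qed (use intN uPL2 uhatL2 in auto)
  ultimately have J_uP: "?J uP \<le> ?J uhat"
    using beta uPL2 uhatL2 by (simp add: J D_def)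

  define um where "um t = (1/2) *\<^sub>R (ubar t + uhat t)" for t
  have umL2: "um \<in> L2 T UNIV"
    using L2_add_scaled[OF ubarL2 uhatL2, of "1/2" "1/2"] by (simp add: um_def[abs_def] scaleR_add_right)
  have diffL2: "(\<lambda>t. ubar t - uhat t) \<in> L2 T UNIV"
    using L2_add_scaled[OF ubarL2 uhatL2, of 1 "-1"] by simp
  have S_um: "?S um t = (1/2) *\<^sub>R (?S ubar t + ?S uhat t)" if "t \<in> {0..T}" for t
    by (rule G.mild_midpoint[OF ubarL2 uhatL2 umL2 um_def G.reduced_state_mild[OF ubarL2]
          G.reduced_state_mild[OF uhatL2] G.reduced_state_mild[OF umL2] that])
  have "D um \<le> (LINT t|time_measure T. 1/2 * (norm (C t (\<iota> (?S ubar t)) - yd t))\<^sup>2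
                  + 1/2 * (norm (C t (\<iota> (?S uhat t)) - yd t))\<^sup>2)"
    unfolding D_def
  proof (rule integral_mono)
    fix t assume "t \<in> space (time_measure T)"
    then have t: "t \<in> {0..T}" by simp
    define a where "a = C t (\<iota> (?S ubar t)) - yd t"
    define b where "b = C t (\<iota> (?S uhat t)) - yd t"
    have "yd t = (1/2) *\<^sub>R (yd t + yd t)"
      by (simp flip: scaleR_2)
    then have "C t (\<iota> (?S um t)) - yd t = (1/2) *\<^sub>R (a + b)"
      unfolding S_um[OF t] a_def b_def
      by (simp add: blinfun.scaleR_right blinfun.add_right algebra_simps)
    then show "(norm (C t (\<iota> (?S um t)) - yd t))\<^sup>2
        \<le> 1/2 * (norm (C t (\<iota> (?S ubar t)) - yd t))\<^sup>2 + 1/2 * (norm (C t (\<iota> (?S uhat t)) - yd t))\<^sup>2"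
      using norm_midpoint_square[of a b] by (simp add: a_def b_def)
  qed (use intS umL2 ubarL2 uhatL2 in auto)
  also have "\<dots> = 1/2 * D ubar + 1/2 * D uhat"
    unfolding D_def using intS[OF ubarL2] intS[OF uhatL2] by simp
  finally have D_um: "D um \<le> 1/2 * D ubar + 1/2 * D uhat" .
  have N_um: "N um = 1/2 * N ubar + 1/2 * N uhat - 1/4 * N (\<lambda>t. ubar t - uhat t)"
    unfolding N_def um_def norm_midpoint_square
    using intN[OF ubarL2] intN[OF uhatL2] intN[OF diffL2] by simp

  have "?J ubar \<le> ?J uP" "?J uhat \<le> ?J um"
    using uhat ubar uP umL2 by (auto simp: is_arg_min_def not_less)
  with J_uP have "?J ubar \<le> ?J uhat" "?J uhat \<le> ?J um" by auto
  moreover have "?J um \<le> 1/2 * ?J ubar + 1/2 * ?J uhat - \<beta>/8 * N (\<lambda>t. ubar t - uhat t)"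
    using D_um by (simp add: J umL2 ubarL2 uhatL2 N_um algebra_simps)
  ultimately have "\<beta>/8 * N (\<lambda>t. ubar t - uhat t) \<le> 0" by linarith
  then have "N (\<lambda>t. ubar t - uhat t) \<le> 0"
    using beta by (simp add: mult_le_0_iff)
  moreover have "0 \<le> N (\<lambda>t. ubar t - uhat t)"
    by (simp add: N_def)
  ultimately have "N (\<lambda>t. ubar t - uhat t) = 0" by simp
  then have "AE t in time_measure T. (norm (ubar t - uhat t))\<^sup>2 = 0"
    using integral_nonneg_eq_0_iff_AE[OF intN[OF diffL2]] by (simp add: N_def)
  then have ae: "AE t in time_measure T. ubar t = uhat t"
    by eventually_elim simp
  then have "?S ubar = ?S uhat"
    by (intro reduced_state_cong) (auto elim: eventually_mono)
  then show ?thesis using ae by simp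
qed

end
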